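(* For $X\sim N(\theta^*,\sigma^2I_n)$ and every $k\in[n]$, $$\inf_{\widehat{\theta}}\sup_{\theta^*\in\Theta_{k}}\mathbb{E}\|\widehat{\theta}-\theta^*\|^2\asymp\begin{cases} \sigma^2, & k=1, \\ \sigma^2\log\log(16n), & k=2, \\ \sigma^2k\log(en/k), & k\geq 3, \end{cases}$$ where $\asymp$ means that the left side is bounded above and below by the right side up to universal positive constant factors (independent of $n,k,\sigma$), and the infimum is over all measurable functions of $X$.
   Context: $[n]=\{1,\dots,n\}$. For reals $a\le b$, $(a:b]$ is the set of integers $i$ with $a<i\le b$. For $k\in[n]$, $\Theta_k$ is the set of $\theta\in\mathbb{R}^n$ for which there exist integers $0=a_0\le a_1\le\cdots\le a_k=n$ and reals $\mu_1,\dots,\mu_k$ (no ordering constraint) with $\theta_i=\mu_j$ for all $i\in(a_{j-1}:a_j]$. *)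

theory Defs
  imports "HOL-Probability.Probability"
begin

text \<open>Vectors in R^n are represented as functions nat => real; coordinate i+1 of the
paper corresponds to index i < n here (0-based).\<close>

text \<open>Theta_k: piecewise constant vectors with at most k pieces.
Breakpoints 0 = a_0 <= a_1 <= ... <= a_k = n, and theta_i = mu_j for i in (a_{j-1}:a_j]
(paper's 1-based i, i.e. index i-1 here).\<close>
definition Theta :: "nat \<Rightarrow> nat \<Rightarrow> (nat \<Rightarrow> real) set" where
  "Theta n k = {\<theta>. \<exists>(a::nat \<Rightarrow> nat) (\<mu>::nat \<Rightarrow> real).
      a 0 = 0 \<and> a k = n \<and> (\<forall>j<k. a j \<le> a (Suc j)) \<and>
      (\<forall>j\<in>{1..k}. \<forall>i. a (j - 1) < i \<and> i \<le> a j \<longrightarrow> \<theta> (i - 1) = \<mu> j)}"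

definition gauss :: "nat \<Rightarrow> real \<Rightarrow> (nat \<Rightarrow> real) \<Rightarrow> (nat \<Rightarrow> real) measure" where
  "gauss n \<sigma> \<theta> = (\<Pi>\<^sub>M i\<in>{..<n}. density lborel (normal_density (\<theta> i) \<sigma>))"

definition estimators :: "nat \<Rightarrow> ((nat \<Rightarrow> real) \<Rightarrow> (nat \<Rightarrow> real)) set" where
  "estimators n = {f. \<forall>i<n. (\<lambda>x. f x i) \<in> borel_measurable (\<Pi>\<^sub>M i\<in>{..<n}. (lborel :: real measure))}"

definition risk :: "nat \<Rightarrow> real \<Rightarrow> ((nat \<Rightarrow> real) \<Rightarrow> (nat \<Rightarrow> real)) \<Rightarrow> (nat \<Rightarrow> real) \<Rightarrow> ennreal" where
  "risk n \<sigma> est \<theta> = (\<integral>\<^sup>+ x. ennreal (\<Sum>i<n. (est x i - \<theta> i)\<^sup>2) \<partial>gauss n \<sigma> \<theta>)"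

definition minimax_risk :: "nat \<Rightarrow> nat \<Rightarrow> real \<Rightarrow> ennreal" where
  "minimax_risk n k \<sigma> = (INF est\<in>estimators n. SUP \<theta>\<in>Theta n k. risk n \<sigma> est \<theta>)"

definition rate :: "nat \<Rightarrow> nat \<Rightarrow> real \<Rightarrow> real" where
  "rate n k \<sigma> = (if k = 1 then \<sigma>\<^sup>2
                 else if k = 2 then \<sigma>\<^sup>2 * ln (ln (16 * real n))
                 else \<sigma>\<^sup>2 * real k * ln (exp 1 * real n / real k))"

end

theory Submission
  imports Defs
begin

text \<open>
  Everything rests on the jump set of a vector: \<open>\<Theta>\<^sub>k\<close> consists of the vectors with at most \<open>k - 1\<close> jumps.

  Lower bounds: if a null vector cannot be told apart from a uniform mixture of alternatives at distance
  \<open>\<rho>\<close> from it, because the second moment of the mixture likelihood ratio is bounded, then every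
  estimator has risk of order \<open>\<rho>\<^sup>2\<close> at the null or on average over the alternatives. A single
  constant vector gives \<open>\<sigma>\<^sup>2\<close>. For \<open>k = 2\<close> the alternatives are \<open>\<rho> 2\<^sup>-\<^sup>j\<close> on the first
  \<open>4\<^sup>j\<close> coordinates; there are about \<open>log n\<close> of them and they are nearly orthogonal. For
  \<open>k \<ge> 3\<close> about \<open>k / 2\<close> disjoint blocks of length about \<open>n / k\<close> carry independently either
  nothing or one spike of squared height \<open>\<sigma>\<^sup>2 log (n / k)\<close> at a uniform position.

  Upper bounds: the loss of least squares is at most four times the sum of \<open>S\<^sub>X\<^sup>2 / |X|\<close> over the
  blocks \<open>X\<close> of any common refinement of the true and the fitted partition, where \<open>S\<^sub>X\<close> is the noise
  in \<open>X\<close>. Writing \<open>U\<^sub>X = S\<^sub>X\<^sup>2 / (4 \<sigma>\<^sup>2 |X|)\<close>, one has \<open>E exp U\<^sub>X \<le> 2\<close>, and the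
  tangent inequality \<open>U \<le> ln R + exp U / R\<close> replaces a maximum over a family of blocks by a sum of
  exponentials, with no independence needed between blocks. For \<open>k \<ge> 3\<close> a grid of mesh about \<open>n / k\<close>
  is added to the refinement, so that only about \<open>n\<^sup>2 / k\<close> short intervals compete. For \<open>k = 2\<close> every
  block starts or ends at \<open>0\<close>, \<open>n\<close> or the true change point, so only four families of partial sums
  matter, and chaining along binary expansions bounds their normalised maxima by \<open>log log n\<close>.
\<close>

section \<open>Gaussian product measures\<close>

abbreviation leb :: "nat \<Rightarrow> (nat \<Rightarrow> real) measure" where
  "leb n \<equiv> \<Pi>\<^sub>M i\<in>{..<n}. (lborel :: real measure)"

definition gdens :: "nat \<Rightarrow> real \<Rightarrow> (nat \<Rightarrow> real) \<Rightarrow> (nat \<Rightarrow> real) \<Rightarrow> real" where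
  "gdens n \<sigma> \<theta> x = (\<Prod>i<n. normal_density (\<theta> i) \<sigma> (x i))"

lemma sets_gauss [measurable_cong]: "sets (gauss n \<sigma> \<theta>) = sets (leb n)"
  unfolding gauss_def by (intro sets_PiM_cong) auto

lemma measurable_gdens [measurable]: "gdens n \<sigma> \<theta> \<in> borel_measurable (leb n)"
  unfolding gdens_def by measurable

lemma gdens_nonneg [simp]: "0 \<le> gdens n \<sigma> \<theta> x"
  unfolding gdens_def by (intro prod_nonneg) auto

lemma prob_space_gauss: "0 < \<sigma> \<Longrightarrow> prob_space (gauss n \<sigma> \<theta>)"
  unfolding gauss_def by (intro prob_space_PiM prob_space_normal_density)

text \<open>Puts all means over one reference measure, so that risks at different vectors become
  integrals of pointwise comparable functions. Product measures are determined by their values on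
  boxes, where the integrand factorises.\<close>

lemma gauss_eq_density:
  assumes "0 < \<sigma>"
  shows "gauss n \<sigma> \<theta> = density (leb n) (\<lambda>x. ennreal (gdens n \<sigma> \<theta> x))"
proof -
  let ?N = "\<lambda>i. density lborel (\<lambda>x. ennreal (normal_density (\<theta> i) \<sigma> x))"
  interpret N: product_prob_space ?N
    by (intro product_prob_spaceI prob_space_normal_density assms)
  interpret L: product_sigma_finite "\<lambda>i::nat. lborel :: real measure" ..
  have "density (leb n) (\<lambda>x. ennreal (gdens n \<sigma> \<theta> x)) = (\<Pi>\<^sub>M i\<in>{..<n}. ?N i)"
  proof (rule N.PiM_eqI)
    show "sets (density (leb n) (\<lambda>x. ennreal (gdens n \<sigma> \<theta> x))) = sets (\<Pi>\<^sub>M i\<in>{..<n}. ?N i)"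
      using sets_gauss[of n \<sigma> \<theta>] by (simp add: gauss_def)
    fix A assume A: "\<And>i. i \<in> {..<n} \<Longrightarrow> A i \<in> sets (?N i)"
    then have A': "\<And>i. i < n \<Longrightarrow> A i \<in> sets borel" by simp
    have PE: "Pi\<^sub>E {..<n} A \<in> sets (leb n)"
      by (rule sets_PiM_I_finite) (use A' in auto)
    have "emeasure (density (leb n) (\<lambda>x. ennreal (gdens n \<sigma> \<theta> x))) (Pi\<^sub>E {..<n} A)
      = (\<integral>\<^sup>+x. ennreal (gdens n \<sigma> \<theta> x) * indicator (Pi\<^sub>E {..<n} A) x \<partial>leb n)"
      by (rule emeasure_density[OF _ PE]) measurable
    also have "\<dots> = (\<integral>\<^sup>+x. (\<Prod>i<n. ennreal (normal_density (\<theta> i) \<sigma> (x i)) * indicator (A i) (x i)) \<partial>leb n)"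
    proof (rule nn_integral_cong)
      fix x assume x: "x \<in> space (leb n)"
      have "indicator (Pi\<^sub>E {..<n} A) x = (\<Prod>i<n. indicator (A i) (x i) :: ennreal)"
        using x by (auto simp: indicator_def space_PiM PiE_iff prod_zero_iff)
      then show "ennreal (gdens n \<sigma> \<theta> x) * indicator (Pi\<^sub>E {..<n} A) x =
         (\<Prod>i<n. ennreal (normal_density (\<theta> i) \<sigma> (x i)) * indicator (A i) (x i))"
        by (simp add: gdens_def prod.distrib prod_ennreal)
    qed
    also have "\<dots> = (\<Prod>i<n. \<integral>\<^sup>+x. ennreal (normal_density (\<theta> i) \<sigma> x) * indicator (A i) x \<partial>lborel)"
      by (rule L.product_nn_integral_prod) (use A' in \<open>auto intro!: borel_measurable_times_ennreal borel_measurable_indicator\<close>)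
    also have "\<dots> = (\<Prod>i<n. emeasure (?N i) (A i))"
      by (intro prod.cong refl emeasure_density[symmetric]) (use A' in auto)
    finally show "emeasure (density (leb n) (\<lambda>x. ennreal (gdens n \<sigma> \<theta> x))) (Pi\<^sub>E {..<n} A) =
        (\<Prod>i<n. emeasure (?N i) (A i))" .
  qed auto
  then show ?thesis by (simp add: gauss_def)
qed

lemma nn_integral_gauss:
  assumes "0 < \<sigma>" "f \<in> borel_measurable (leb n)"
  shows "(\<integral>\<^sup>+x. f x \<partial>gauss n \<sigma> \<theta>) = (\<integral>\<^sup>+x. ennreal (gdens n \<sigma> \<theta> x) * f x \<partial>leb n)"
  using assms(2) by (subst gauss_eq_density[OF assms(1)]) (rule nn_integral_density, auto)

lemma nn_integral_gdens: "0 < \<sigma> \<Longrightarrow> (\<integral>\<^sup>+x. ennreal (gdens n \<sigma> \<theta> x) \<partial>leb n) = 1"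
  using nn_integral_gauss[of \<sigma> "\<lambda>_. 1" n \<theta>] prob_space.emeasure_space_1[OF prob_space_gauss]
  by simp

section \<open>Likelihood ratios of shifted Gaussian vectors\<close>

lemma normal_density_tilt:
  assumes "0 < \<sigma>"
  shows "normal_density (t + u) \<sigma> x * normal_density (t + v) \<sigma> x
    = exp (u * v / \<sigma>\<^sup>2) * normal_density t \<sigma> x * normal_density (t + u + v) \<sigma> x"
proof -
  \<comment> \<open>The means on both sides add up to \<open>2 * t + u + v\<close>, so the terms in
    \<open>x\<close> agree and only the constant \<open>u * v / \<sigma>\<^sup>2\<close> is left
    over.\<close>
  have "- (x - (t + u))\<^sup>2 / (2 * \<sigma>\<^sup>2) + - (x - (t + v))\<^sup>2 / (2 * \<sigma>\<^sup>2)
    = u * v / \<sigma>\<^sup>2 + - (x - t)\<^sup>2 / (2 * \<sigma>\<^sup>2) + - (x - (t + u + v))\<^sup>2 / (2 * \<sigma>\<^sup>2)"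
    using assms by (simp add: field_simps power2_eq_square)
  then have "exp (- (x - (t + u))\<^sup>2 / (2 * \<sigma>\<^sup>2)) * exp (- (x - (t + v))\<^sup>2 / (2 * \<sigma>\<^sup>2))
    = exp (u * v / \<sigma>\<^sup>2) * exp (- (x - t)\<^sup>2 / (2 * \<sigma>\<^sup>2)) * exp (- (x - (t + u + v))\<^sup>2 / (2 * \<sigma>\<^sup>2))"
    by (simp add: exp_add[symmetric])
  then show ?thesis by (simp add: normal_density_def)
qed

lemma gdens_tilt:
  assumes "0 < \<sigma>"
  shows "gdens n \<sigma> (\<lambda>i. t i + u i) x * gdens n \<sigma> (\<lambda>i. t i + v i) x
    = exp ((\<Sum>i<n. u i * v i) / \<sigma>\<^sup>2) * gdens n \<sigma> t x * gdens n \<sigma> (\<lambda>i. t i + u i + v i) x"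
  unfolding gdens_def
  by (simp add: prod.distrib[symmetric] normal_density_tilt[OF assms] exp_sum sum_divide_distrib)

lemma gdens_pos: "0 < \<sigma> \<Longrightarrow> 0 < gdens n \<sigma> \<theta> x"
  unfolding gdens_def by (intro prod_pos) (auto intro: normal_density_pos)

text \<open>This is the cross moment of two likelihood ratios under the mean \<open>t\<close>. By
  \<open>gdens_tilt\<close> the quotient is a constant times the density with mean
  \<open>t + u + v\<close>, whose total mass is one.\<close>

lemma nn_integral_likelihood_product:
  assumes s: "0 < \<sigma>"
  shows "(\<integral>\<^sup>+x. ennreal (gdens n \<sigma> (\<lambda>i. t i + u i) x * gdens n \<sigma> (\<lambda>i. t i + v i) x / gdens n \<sigma> t x) \<partial>leb n)
    = ennreal (exp ((\<Sum>i<n. u i * v i) / \<sigma>\<^sup>2))"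
proof -
  have "(\<integral>\<^sup>+x. ennreal (gdens n \<sigma> (\<lambda>i. t i + u i) x * gdens n \<sigma> (\<lambda>i. t i + v i) x / gdens n \<sigma> t x) \<partial>leb n)
    = (\<integral>\<^sup>+x. ennreal (exp ((\<Sum>i<n. u i * v i) / \<sigma>\<^sup>2)) * ennreal (gdens n \<sigma> (\<lambda>i. t i + u i + v i) x) \<partial>leb n)"
    using gdens_pos[OF s, of n t]
    by (intro nn_integral_cong) (simp add: gdens_tilt[OF s] ennreal_mult[symmetric] less_imp_neq[symmetric])
  also have "\<dots> = ennreal (exp ((\<Sum>i<n. u i * v i) / \<sigma>\<^sup>2))"
    by (subst nn_integral_cmult) (auto simp: nn_integral_gdens[OF s])
  finally show ?thesis .
qed

section \<open>Laws of coordinates and of block sums\<close>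

lemma measurable_gauss_coordinate:
  assumes "i < n" shows "(\<lambda>x. x i) \<in> borel_measurable (gauss n \<sigma> \<theta>)"
proof -
  have "i \<in> {..<n}" using assms by simp
  then show ?thesis by measurable
qed

lemma indep_vars_gauss:
  assumes s: "0 < \<sigma>" and n: "0 < n"
  shows "prob_space.indep_vars (gauss n \<sigma> \<theta>) (\<lambda>_. borel) (\<lambda>i x. x i) {..<n}"
proof -
  interpret prob_space "gauss n \<sigma> \<theta>" by (rule prob_space_gauss[OF s])
  let ?N = "\<lambda>i. density lborel (\<lambda>x. ennreal (normal_density (\<theta> i) \<sigma> x))"
  have rv: "random_variable borel (\<lambda>x. x i)" if "i < n" for i
    using that by (rule measurable_gauss_coordinate)
  \<comment> \<open>Points of the product space are extensional, so restriction to
    \<open>{..<n}\<close> is the identity there and the joint law of the coordinates is the measure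
    itself.\<close>
  have "distr (gauss n \<sigma> \<theta>) (\<Pi>\<^sub>M i\<in>{..<n}. borel) (\<lambda>x. \<lambda>i\<in>{..<n}. x i)
      = distr (gauss n \<sigma> \<theta>) (gauss n \<sigma> \<theta>) (\<lambda>x. x)"
  proof (rule distr_cong)
    show "sets (\<Pi>\<^sub>M i\<in>{..<n}. borel) = sets (gauss n \<sigma> \<theta>)"
      unfolding sets_gauss by (intro sets_PiM_cong) auto
  qed (auto simp: gauss_def space_PiM PiE_def extensional_def fun_eq_iff)
  also have "\<dots> = (\<Pi>\<^sub>M i\<in>{..<n}. ?N i)" by (simp add: gauss_def)
  also have "\<dots> = (\<Pi>\<^sub>M i\<in>{..<n}. distr (gauss n \<sigma> \<theta>) borel (\<lambda>x. x i))"
  proof (rule PiM_cong)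
    fix i assume i: "i \<in> {..<n}"
    have "distr (gauss n \<sigma> \<theta>) (?N i) (\<lambda>x. x i) = ?N i"
      unfolding gauss_def
      by (rule distr_PiM_component[OF prob_space_normal_density[OF s] i])
    then show "?N i = distr (gauss n \<sigma> \<theta>) borel (\<lambda>x. x i)"
      by (metis (no_types, lifting) distr_cong sets_density sets_lborel)
  qed auto
  finally show ?thesis
    using n rv by (subst indep_vars_iff_distr_eq_PiM') (auto simp: lessThan_empty_iff)
qed

lemma distributed_gauss_coordinate:
  assumes s: "0 < \<sigma>" and i: "i < n"
  shows "distributed (gauss n \<sigma> \<theta>) lborel (\<lambda>x. x i) (normal_density (\<theta> i) \<sigma>)"
proof -
  let ?N = "\<lambda>i. density lborel (\<lambda>x. ennreal (normal_density (\<theta> i) \<sigma> x))"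
  have i': "i \<in> {..<n}" using i by simp
  have "distr (gauss n \<sigma> \<theta>) (?N i) (\<lambda>x. x i) = ?N i"
    unfolding gauss_def
    by (rule distr_PiM_component[OF prob_space_normal_density[OF s] i'])
  then have "distr (gauss n \<sigma> \<theta>) lborel (\<lambda>x. x i) = ?N i"
    by (metis (no_types, lifting) distr_cong sets_density)
  moreover have "(\<lambda>x. x i) \<in> borel_measurable (gauss n \<sigma> \<theta>)"
    by (rule measurable_gauss_coordinate[OF i])
  ultimately show ?thesis
    by (auto simp: distributed_def)
qed

text \<open>This is exp(Z^2/4) for the block sum Z scaled to unit variance. The constant must exceed
  2, because exp(Z^2/2) already has infinite mean.\<close>

definition expsq :: "real \<Rightarrow> (nat \<Rightarrow> real) \<Rightarrow> nat set \<Rightarrow> real" where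
  "expsq \<sigma> e J = exp ((\<Sum>i\<in>J. e i)\<^sup>2 / (4 * \<sigma>\<^sup>2 * real (card J)))"

text \<open>The factor cancels half of the Gaussian exponent, which doubles the variance; the
  normalising constant then changes by \<open>sqrt 2\<close>.\<close>

lemma normal_density_expsq:
  assumes v: "0 < v"
  shows "normal_density m v t * exp ((t - m)\<^sup>2 / (4 * v\<^sup>2)) = sqrt 2 * normal_density m (sqrt 2 * v) t"
proof -
  have "- (t - m)\<^sup>2 / (2 * v\<^sup>2) + (t - m)\<^sup>2 / (4 * v\<^sup>2) = - (t - m)\<^sup>2 / (2 * (sqrt 2 * v)\<^sup>2)"
    using v by (simp add: field_simps power_mult_distrib)
  then have "exp (- (t - m)\<^sup>2 / (2 * v\<^sup>2)) * exp ((t - m)\<^sup>2 / (4 * v\<^sup>2)) = exp (- (t - m)\<^sup>2 / (2 * (sqrt 2 * v)\<^sup>2))"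
    by (simp add: exp_add[symmetric])
  moreover have "sqrt (2 * pi * (sqrt 2 * v)\<^sup>2) = sqrt 2 * sqrt (2 * pi * v\<^sup>2)"
    by (simp add: power_mult_distrib real_sqrt_mult)
  ultimately show ?thesis
    by (simp add: normal_density_def)
qed

text \<open>The sum over \<open>J\<close> is normal with variance
  \<open>\<sigma>\<^sup>2 * card J\<close>, so the tilted density is \<open>sqrt 2\<close> times a
  probability density. The bound is the same for every \<open>J\<close>, whatever its size.\<close>

lemma nn_integral_expsq_le:
  assumes s: "0 < \<sigma>" and J: "J \<subseteq> {..<n}"
  shows "(\<integral>\<^sup>+x. ennreal (expsq \<sigma> (\<lambda>i. x i - \<theta> i) J) \<partial>gauss n \<sigma> \<theta>) \<le> 2"
\<comment> \<open>For the empty block the quotient is 0 / 0 = 0, so the integrand is constantly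
  1.\<close>
proof (cases "J = {}")
  case True
  then show ?thesis
    using prob_space.emeasure_space_1[OF prob_space_gauss[OF s, of n \<theta>]] by (simp add: expsq_def)
next
  case False
  interpret prob_space "gauss n \<sigma> \<theta>" by (rule prob_space_gauss[OF s])
  have fin: "finite J" using J finite_subset by blast
  have n: "0 < n" using J False by (cases "n = 0") auto
  define v where "v = sqrt (\<Sum>i\<in>J. \<sigma>\<^sup>2)"
  define m where "m = (\<Sum>i\<in>J. \<theta> i)"
  have v2: "v\<^sup>2 = \<sigma>\<^sup>2 * real (card J)"
    by (simp add: v_def)
  have v: "0 < v" using s False fin by (simp add: v_def card_gt_0_iff)
  have D: "distributed (gauss n \<sigma> \<theta>) lborel (\<lambda>x. \<Sum>i\<in>J. x i) (normal_density m v)"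
    unfolding m_def v_def
    by (rule sum_indep_normal[OF fin False])
       (use J s in \<open>auto intro!: indep_vars_subset[OF indep_vars_gauss[OF s n]] distributed_gauss_coordinate\<close>)
  have "(\<integral>\<^sup>+x. ennreal (expsq \<sigma> (\<lambda>i. x i - \<theta> i) J) \<partial>gauss n \<sigma> \<theta>)
     = (\<integral>\<^sup>+x. (\<lambda>t. ennreal (exp ((t - m)\<^sup>2 / (4 * v\<^sup>2)))) (\<Sum>i\<in>J. x i) \<partial>gauss n \<sigma> \<theta>)"
    by (simp add: expsq_def sum_subtractf m_def v2 mult.assoc)
  also have "\<dots> = (\<integral>\<^sup>+t. ennreal (normal_density m v t) * ennreal (exp ((t - m)\<^sup>2 / (4 * v\<^sup>2))) \<partial>lborel)"
    by (rule distributed_nn_integral[symmetric, OF D]) measurable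
  also have "\<dots> = (\<integral>\<^sup>+t. ennreal (sqrt 2) * ennreal (normal_density m (sqrt 2 * v) t) \<partial>lborel)"
    by (intro nn_integral_cong) (simp add: ennreal_mult[symmetric] normal_density_expsq[OF v])
  also have "\<dots> = ennreal (sqrt 2) * 1"
  proof (subst nn_integral_cmult)
    have "0 < sqrt 2 * v" using v by simp
    then have "emeasure (density lborel (normal_density m (sqrt 2 * v))) UNIV = 1"
      using prob_space.emeasure_space_1[OF prob_space_normal_density] by fastforce
    then show "ennreal (sqrt 2) * (\<integral>\<^sup>+t. ennreal (normal_density m (sqrt 2 * v) t) \<partial>lborel) = ennreal (sqrt 2) * 1"
      by (simp add: emeasure_density)
  qed auto
  also have "\<dots> \<le> ennreal 2"
    using sqrt2_less_2 by (simp add: ennreal_leI less_imp_le del: ennreal_numeral)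
  finally show ?thesis by simp
qed

section \<open>Detection lower bound\<close>

text \<open>Counts the loss on \<open>P\<close> only. Risks over disjoint blocks add up to at most
  the full risk, which is how the spike bound collects one contribution per block.\<close>

definition prisk :: "nat \<Rightarrow> real \<Rightarrow> nat set \<Rightarrow> ((nat \<Rightarrow> real) \<Rightarrow> nat \<Rightarrow> real) \<Rightarrow> (nat \<Rightarrow> real) \<Rightarrow> ennreal" where
  "prisk n \<sigma> P est \<theta> = (\<integral>\<^sup>+ x. ennreal (\<Sum>i\<in>P. (est x i - \<theta> i)\<^sup>2) \<partial>gauss n \<sigma> \<theta>)"

lemma risk_eq_prisk: "risk n \<sigma> est \<theta> = prisk n \<sigma> {..<n} est \<theta>"
  by (simp add: risk_def prisk_def)

lemma measurable_ploss:
  assumes "est \<in> estimators n" "P \<subseteq> {..<n}"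
  shows "(\<lambda>x. \<Sum>i\<in>P. (est x i - \<theta> i)\<^sup>2) \<in> borel_measurable (leb n)"
proof (rule borel_measurable_sum)
  fix i assume "i \<in> P"
  then have [measurable]: "(\<lambda>x. est x i) \<in> borel_measurable (leb n)"
    using assms by (auto simp: estimators_def)
  show "(\<lambda>x. (est x i - \<theta> i)\<^sup>2) \<in> borel_measurable (leb n)" by measurable
qed

text \<open>Here \<open>w\<close> is the error at the null and \<open>w - v\<close> the error at the
  alternative. Since \<open>v\<close> is their difference, its squared norm is at most twice the sum
  of theirs, so both cannot be small.\<close>

lemma two_point_tradeoff:
  fixes w v :: "nat \<Rightarrow> real"
  assumes "(\<Sum>i\<in>P. (v i)\<^sup>2) = r" "(\<Sum>i\<in>P. (w i)\<^sup>2) \<le> r / 4"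
  shows "r / 4 \<le> (\<Sum>i\<in>P. (w i - v i)\<^sup>2)"
proof -
  have "r \<le> (\<Sum>i\<in>P. 2 * (w i - v i)\<^sup>2 + 2 * (w i)\<^sup>2)"
    unfolding assms(1)[symmetric]
  proof (rule sum_mono)
    fix i
    have "0 \<le> (2 * w i - v i)\<^sup>2" by simp
    then show "(v i)\<^sup>2 \<le> 2 * (w i - v i)\<^sup>2 + 2 * (w i)\<^sup>2"
      by (simp add: power2_eq_square algebra_simps)
  qed
  also have "\<dots> = 2 * (\<Sum>i\<in>P. (w i - v i)\<^sup>2) + 2 * (\<Sum>i\<in>P. (w i)\<^sup>2)"
    by (simp add: sum.distrib sum_distrib_left)
  finally show ?thesis using assms(2) by simp
qed

text \<open>\<open>h\<close> and \<open>A j\<close> are the losses at the null and at the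
  alternatives, \<open>g0\<close> and \<open>g j\<close> the densities, \<open>G\<close> the mixture
  density. Where the null loss is small, every alternative loses at least \<open>r / 4\<close>;
  where it is large, the term with \<open>h\<close> pays, at the price of the second moment term
  \<open>G\<^sup>2 / g0\<close>.\<close>

lemma detection_pointwise:
  fixes g A :: "'j \<Rightarrow> real"
  assumes I: "finite I" "I \<noteq> {}" and g0: "0 < g0" and g: "\<And>j. j \<in> I \<Longrightarrow> 0 \<le> g j"
    and r: "0 < r" and K: "0 < K" and h: "0 \<le> h"
    and A: "\<And>j. j \<in> I \<Longrightarrow> 0 \<le> A j" "\<And>j. j \<in> I \<Longrightarrow> h \<le> r / 4 \<Longrightarrow> r / 4 \<le> A j"
  defines "G \<equiv> (\<Sum>j\<in>I. g j) / real (card I)"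
  shows "r / 4 * G \<le> (\<Sum>j\<in>I. g j * A j) / real (card I) + r / (8 * K) * (G\<^sup>2 / g0) + K / 2 * (g0 * h)"
proof (cases "h \<le> r / 4")
  case True
  have "r / 4 * (\<Sum>j\<in>I. g j) \<le> (\<Sum>j\<in>I. g j * A j)"
    unfolding sum_distrib_left
  proof (rule sum_mono)
    fix j assume "j \<in> I"
    then show "r / 4 * g j \<le> g j * A j"
      using mult_left_mono[OF A(2)[of j] g[of j]] True by (simp add: mult.commute)
  qed
  from divide_right_mono[OF this, of "real (card I)"]
  have "r / 4 * G \<le> (\<Sum>j\<in>I. g j * A j) / real (card I)"
    unfolding G_def by simp
  moreover have "0 \<le> r / (8 * K) * (G\<^sup>2 / g0)" "0 \<le> K / 2 * (g0 * h)"
    using r K g0 h by auto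
  ultimately show ?thesis by linarith
next
  case False
  \<comment> \<open>This square encodes 2 K G <= G^2/g0 + K^2 g0, scaled by
    \<open>r / (8 * K)\<close>. With that scaling a second moment of at most \<open>K\<close> costs
    only half of the available \<open>r / 4\<close>.\<close>
  have "0 \<le> r / (8 * K * g0) * (G - K * g0)\<^sup>2" using r K g0 by simp
  also have "\<dots> = r / (8 * K) * (G\<^sup>2 / g0) + K / 2 * (g0 * (r / 4)) - r / 4 * G"
    using K g0 by (simp add: power2_eq_square field_simps)
  finally have "r / 4 * G \<le> r / (8 * K) * (G\<^sup>2 / g0) + K / 2 * (g0 * (r / 4))" by simp
  also have "\<dots> \<le> r / (8 * K) * (G\<^sup>2 / g0) + K / 2 * (g0 * h)"
    using K g0 False by (intro add_left_mono mult_left_mono) auto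
  also have "\<dots> \<le> (\<Sum>j\<in>I. g j * A j) / real (card I) + \<dots>"
    using g A(1) by (simp add: sum_nonneg)
  finally show ?thesis by simp
qed

text \<open>Integrates \<open>detection_pointwise\<close>. Hypothesis \<open>chi\<close> bounds the
  second moment of the mixture likelihood ratio by \<open>K\<close>. The centre \<open>t\<close> is
  arbitrary, so the alternatives may sit on top of a background.\<close>

lemma detection_lower_bound:
  fixes v :: "'j \<Rightarrow> nat \<Rightarrow> real" and t :: "nat \<Rightarrow> real"
  assumes s: "0 < \<sigma>" and est: "est \<in> estimators n" and P: "P \<subseteq> {..<n}"
    and I: "finite I" "I \<noteq> {}" and r: "0 < r" and K: "0 < K"
    and norm: "\<And>j. j \<in> I \<Longrightarrow> (\<Sum>i\<in>P. (v j i)\<^sup>2) = r"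
    and chi: "(\<Sum>i\<in>I. \<Sum>j\<in>I. exp ((\<Sum>c<n. v i c * v j c) / \<sigma>\<^sup>2)) \<le> K * (real (card I))\<^sup>2"
  shows "ennreal (r / 8) \<le> ennreal (1 / real (card I)) * (\<Sum>j\<in>I. prisk n \<sigma> P est (\<lambda>i. t i + v j i))
     + ennreal (K / 2) * prisk n \<sigma> P est t"
proof -
  define N where "N = real (card I)"
  have N: "0 < N" using I by (simp add: N_def card_gt_0_iff)
  define g where "g j = gdens n \<sigma> (\<lambda>i. t i + v j i)" for j
  define g0 where "g0 = gdens n \<sigma> t"
  define A where "A j x = (\<Sum>i\<in>P. (est x i - (t i + v j i))\<^sup>2)" for j x
  define h where "h x = (\<Sum>i\<in>P. (est x i - t i)\<^sup>2)" for x
  define G where "G x = (\<Sum>j\<in>I. g j x) / N" for x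
  have [measurable]: "A j \<in> borel_measurable (leb n)" "h \<in> borel_measurable (leb n)"
     "g j \<in> borel_measurable (leb n)" "g0 \<in> borel_measurable (leb n)" for j
    using measurable_ploss[OF est P] by (auto simp: A_def[abs_def] h_def[abs_def] g_def g0_def)
  have [measurable]: "G \<in> borel_measurable (leb n)" unfolding G_def by measurable
  have nn: "0 \<le> A j x" "0 \<le> h x" "0 \<le> g j x" "0 \<le> g0 x" "0 \<le> G x" for j x
    using N by (auto simp: A_def h_def g_def g0_def G_def intro!: sum_nonneg divide_nonneg_pos)
  have g0: "0 < g0 x" for x using gdens_pos[OF s] by (simp add: g0_def)
  have pw: "r / 4 * G x \<le> (\<Sum>j\<in>I. g j x * A j x) / N + r / (8 * K) * ((G x)\<^sup>2 / g0 x) + K / 2 * (g0 x * h x)" for x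
    unfolding G_def N_def
  proof (rule detection_pointwise[OF I g0 nn(3) r K nn(2) nn(1)])
    fix j assume j: "j \<in> I" "h x \<le> r / 4"
    have "A j x = (\<Sum>i\<in>P. ((est x i - t i) - v j i)\<^sup>2)"
      unfolding A_def by (intro sum.cong) (auto simp: algebra_simps)
    then show "r / 4 \<le> A j x" using two_point_tradeoff[OF norm[OF j(1)], of "\<lambda>i. est x i - t i"] j(2)
      by (simp add: h_def)
  qed
  have G1: "(\<integral>\<^sup>+x. ennreal (G x) \<partial>leb n) = 1"
  proof -
    have "(\<integral>\<^sup>+x. ennreal (G x) \<partial>leb n) = (\<integral>\<^sup>+x. ennreal (1 / N) * (\<Sum>j\<in>I. ennreal (g j x)) \<partial>leb n)"
      using N nn by (intro nn_integral_cong) (simp add: G_def ennreal_mult[symmetric] sum_nonneg)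
    also have "\<dots> = ennreal (1 / N) * (\<Sum>j\<in>I. 1)"
      by (simp add: nn_integral_cmult nn_integral_sum g_def nn_integral_gdens[OF s] del: sum_ennreal)
    also have "\<dots> = 1"
      using N by (simp add: N_def ennreal_of_nat_eq_real_of_nat ennreal_mult[symmetric])
    finally show ?thesis .
  qed
  \<comment> \<open>Expanding the square of the mixture turns this into the average of all pairwise
    cross moments.\<close>
  have G2: "(\<integral>\<^sup>+x. ennreal ((G x)\<^sup>2 / g0 x) \<partial>leb n) \<le> ennreal K"
  proof -
    have "(\<integral>\<^sup>+x. ennreal ((G x)\<^sup>2 / g0 x) \<partial>leb n)
       = (\<integral>\<^sup>+x. ennreal (1 / N\<^sup>2) * (\<Sum>i\<in>I. \<Sum>j\<in>I. ennreal (g i x * g j x / g0 x)) \<partial>leb n)"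
    proof (intro nn_integral_cong)
      fix x
      have "(G x)\<^sup>2 / g0 x = 1 / N\<^sup>2 * (\<Sum>i\<in>I. \<Sum>j\<in>I. g i x * g j x / g0 x)"
        by (simp add: G_def power2_eq_square sum_product sum_divide_distrib[symmetric])
      moreover have "(\<Sum>i\<in>I. \<Sum>j\<in>I. ennreal (g i x * g j x / g0 x)) = ennreal (\<Sum>i\<in>I. \<Sum>j\<in>I. g i x * g j x / g0 x)"
        using nn by (simp add: sum_nonneg)
      ultimately show "ennreal ((G x)\<^sup>2 / g0 x) = ennreal (1 / N\<^sup>2) * (\<Sum>i\<in>I. \<Sum>j\<in>I. ennreal (g i x * g j x / g0 x))"
        by (metis ennreal_mult' nn(4) nn(3) sum_nonneg zero_le_divide_1_iff zero_le_power2)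
    qed
    also have "\<dots> = ennreal (1 / N\<^sup>2) * (\<Sum>i\<in>I. \<Sum>j\<in>I. ennreal (exp ((\<Sum>c<n. v i c * v j c) / \<sigma>\<^sup>2)))"
      by (simp add: nn_integral_cmult nn_integral_sum g_def g0_def nn_integral_likelihood_product[OF s] del: sum_ennreal)
    also have "\<dots> = ennreal (1 / N\<^sup>2) * ennreal (\<Sum>i\<in>I. \<Sum>j\<in>I. exp ((\<Sum>c<n. v i c * v j c) / \<sigma>\<^sup>2))"
      by (simp add: sum_nonneg)
    also have "\<dots> = ennreal (1 / N\<^sup>2 * (\<Sum>i\<in>I. \<Sum>j\<in>I. exp ((\<Sum>c<n. v i c * v j c) / \<sigma>\<^sup>2)))"
      by (rule ennreal_mult'[symmetric]) simp
    also have "\<dots> \<le> ennreal K"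
    proof (rule ennreal_leI)
      have "1 / N\<^sup>2 * (\<Sum>i\<in>I. \<Sum>j\<in>I. exp ((\<Sum>c<n. v i c * v j c) / \<sigma>\<^sup>2)) \<le> 1 / N\<^sup>2 * (K * N\<^sup>2)"
        using chi by (intro mult_left_mono) (auto simp: N_def)
      then show "1 / N\<^sup>2 * (\<Sum>i\<in>I. \<Sum>j\<in>I. exp ((\<Sum>c<n. v i c * v j c) / \<sigma>\<^sup>2)) \<le> K" using N by simp
    qed
    finally show ?thesis .
  qed
  have rj: "(\<integral>\<^sup>+x. ennreal (g j x) * ennreal (A j x) \<partial>leb n) = prisk n \<sigma> P est (\<lambda>i. t i + v j i)" for j
    unfolding prisk_def g_def A_def[symmetric] by (subst nn_integral_gauss[OF s]) auto
  have r0: "(\<integral>\<^sup>+x. ennreal (g0 x) * ennreal (h x) \<partial>leb n) = prisk n \<sigma> P est t"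
    unfolding prisk_def g0_def h_def[symmetric] by (subst nn_integral_gauss[OF s]) auto
  let ?R = "ennreal (1 / N) * (\<Sum>j\<in>I. prisk n \<sigma> P est (\<lambda>i. t i + v j i))"
  have "ennreal (r / 4) = (\<integral>\<^sup>+x. ennreal (r / 4) * ennreal (G x) \<partial>leb n)"
    by (simp add: nn_integral_cmult G1)
  also have "\<dots> \<le> (\<integral>\<^sup>+x. ennreal (1 / N) * (\<Sum>j\<in>I. ennreal (g j x) * ennreal (A j x))
     + ennreal (r / (8 * K)) * ennreal ((G x)\<^sup>2 / g0 x) + ennreal (K / 2) * (ennreal (g0 x) * ennreal (h x)) \<partial>leb n)"
  proof (rule nn_integral_mono)
    fix x
    have "ennreal (r / 4) * ennreal (G x) = ennreal (r / 4 * G x)"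
      using r nn by (subst ennreal_mult) auto
    also have "\<dots> \<le> ennreal ((\<Sum>j\<in>I. g j x * A j x) / N + r / (8 * K) * ((G x)\<^sup>2 / g0 x) + K / 2 * (g0 x * h x))"
      by (rule ennreal_leI[OF pw])
    also have "\<dots> = ennreal (1 / N) * (\<Sum>j\<in>I. ennreal (g j x) * ennreal (A j x))
     + ennreal (r / (8 * K)) * ennreal ((G x)\<^sup>2 / g0 x) + ennreal (K / 2) * (ennreal (g0 x) * ennreal (h x))"
    proof -
      have 1: "ennreal (1 / N) * (\<Sum>j\<in>I. ennreal (g j x) * ennreal (A j x)) = ennreal ((\<Sum>j\<in>I. g j x * A j x) / N)"
        using N nn by (simp add: ennreal_mult[symmetric] sum_nonneg)
      have 2: "ennreal (r / (8 * K)) * ennreal ((G x)\<^sup>2 / g0 x) = ennreal (r / (8 * K) * ((G x)\<^sup>2 / g0 x))"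
        using r K nn by (subst ennreal_mult) auto
      have 3: "ennreal (K / 2) * (ennreal (g0 x) * ennreal (h x)) = ennreal (K / 2 * (g0 x * h x))"
        using K nn by (simp add: ennreal_mult del: times_divide_eq_left)
      have "0 \<le> (\<Sum>j\<in>I. g j x * A j x) / N" "0 \<le> r / (8 * K) * ((G x)\<^sup>2 / g0 x)" "0 \<le> K / 2 * (g0 x * h x)"
        using N nn r K by (auto intro!: sum_nonneg mult_nonneg_nonneg divide_nonneg_nonneg)
      then show ?thesis unfolding 1 2 3 by (simp add: ennreal_plus)
    qed
    finally show "ennreal (r / 4) * ennreal (G x) \<le> \<dots>" .
  qed
  also have "\<dots> = ?R + ennreal (r / (8 * K)) * (\<integral>\<^sup>+x. ennreal ((G x)\<^sup>2 / g0 x) \<partial>leb n) + ennreal (K / 2) * prisk n \<sigma> P est t"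
    by (simp add: nn_integral_add nn_integral_cmult nn_integral_sum rj r0)
  also have "\<dots> \<le> ?R + ennreal (r / (8 * K)) * ennreal K + ennreal (K / 2) * prisk n \<sigma> P est t"
    by (intro add_mono order_refl mult_left_mono G2) auto
  also have "ennreal (r / (8 * K)) * ennreal K = ennreal (r / 8)"
    using r K by (simp add: ennreal_mult[symmetric])
  \<comment> \<open>The risks may be infinite, so the subtraction is carried out by cancelling the
    finite summand \<open>r / 8\<close>.\<close>
  finally have "ennreal (r / 8) + ennreal (r / 8) \<le> ennreal (r / 8) + (?R + ennreal (K / 2) * prisk n \<sigma> P est t)"
    using r by (simp add: ennreal_plus[symmetric] add_ac del: ennreal_plus)
  then show ?thesis unfolding N_def by (simp add: ennreal_add_left_cancel_le)
qed

section \<open>Jump sets and lower bounds for one and two pieces\<close>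

definition jumps :: "nat \<Rightarrow> (nat \<Rightarrow> real) \<Rightarrow> nat set" where
  "jumps n \<theta> = {i \<in> {1..<n}. \<theta> i \<noteq> \<theta> (i - 1)}"

text \<open>The level sets of \<open>cell A\<close> are the blocks of consecutive indices cut out by the
  starting points in \<open>A\<close>.\<close>

definition cell :: "nat set \<Rightarrow> nat \<Rightarrow> nat" where
  "cell A i = card {a \<in> A. a \<le> i}"

lemma finite_jumps [simp]: "finite (jumps n \<theta>)"
  by (simp add: jumps_def)

lemma cell_mono: "finite A \<Longrightarrow> i \<le> j \<Longrightarrow> cell A i \<le> cell A j"
  unfolding cell_def by (rule card_mono) auto

lemma cell_le_card: "finite A \<Longrightarrow> cell A i \<le> card A"
  unfolding cell_def by (rule card_mono) auto

lemma cell_less: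
  assumes "finite A" "a \<in> A" "i < a" "a \<le> j" shows "cell A i < cell A j"
proof -
  have "a \<in> {a \<in> A. a \<le> j}" "a \<notin> {a \<in> A. a \<le> i}" "{a \<in> A. a \<le> i} \<subseteq> {a \<in> A. a \<le> j}"
    using assms by auto
  then have "{a \<in> A. a \<le> i} \<subset> {a \<in> A. a \<le> j}" by blast
  then show ?thesis
    unfolding cell_def using assms(1) by (intro psubset_card_mono) auto
qed

lemma cell_eq_imp_no_jump:
  assumes "finite A" "i \<le> j" "cell A i = cell A j" "a \<in> A"
  shows "\<not> (i < a \<and> a \<le> j)"
  using cell_less[OF assms(1,4), of i j] assms(3) by auto

text \<open>Equal counts mean that no point of \<open>A\<close>, hence no jump, lies after the
  smaller index up to the larger one.\<close>

lemma constant_on_cell: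
  assumes A: "finite A" "jumps n v \<subseteq> A" and ij: "i < n" "j < n" "cell A i = cell A j"
  shows "v i = v j"
proof -
  have *: "v i = v j" if "i \<le> j" "j < n" "cell A i = cell A j" for i j
    using that
  proof (induction j rule: dec_induct)
    case (step m)
    have "cell A i \<le> cell A m" "cell A m \<le> cell A (Suc m)"
      using cell_mono[OF A(1)] step.hyps by auto
    with step.prems have "cell A i = cell A m" by simp
    then have "v i = v m" using step by simp
    moreover have "Suc m \<notin> A"
      using cell_eq_imp_no_jump[OF A(1), of i "Suc m" "Suc m"] step by auto
    then have "v (Suc m) = v m"
      using A(2) step.prems by (auto simp: jumps_def)
    ultimately show ?case by simp
  qed simp
  show ?thesis using * ij by (metis nat_le_linear)
qed

text \<open>Every jump is one of the interior breakpoints \<open>a 1\<close>, ...,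
  \<open>a (k - 1)\<close>: it equals \<open>a (j - 1)\<close> for the least \<open>j\<close> with
  \<open>i < a j\<close>.\<close>

lemma ThetaD:
  assumes "\<theta> \<in> Theta n k"
  shows "card (jumps n \<theta>) \<le> k - 1"
proof -
  obtain a \<mu> where a: "a 0 = 0" "a k = n" "\<And>j. j < k \<Longrightarrow> a j \<le> a (Suc j)"
    and m: "\<And>j i. j \<in> {1..k} \<Longrightarrow> a (j - 1) < i \<Longrightarrow> i \<le> a j \<Longrightarrow> \<theta> (i - 1) = \<mu> j"
    using assms unfolding Theta_def by blast
  have "jumps n \<theta> \<subseteq> a ` {1..<k}"
  proof
    fix i assume i: "i \<in> jumps n \<theta>"
    then have i1: "1 \<le> i" "i < n" and ne: "\<theta> i \<noteq> \<theta> (i - 1)" by (auto simp: jumps_def)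
    define j where "j = (LEAST j. i < a j)"
    have "i < a k" using i1 a by simp
    then have j: "i < a j" "j \<le> k" unfolding j_def by (rule LeastI, rule Least_le)
    have j0: "j \<noteq> 0" using j a by (metis not_less_zero)
    have jm: "a (j - 1) \<le> i"
      using not_less_Least[of "j - 1" "\<lambda>j. i < a j"] j0 unfolding j_def[symmetric] by simp
    \<comment> \<open>Otherwise the one-based positions \<open>i\<close> and \<open>Suc i\<close>
      lie in the same piece, which contradicts the jump at the zero-based index
      \<open>i\<close>.\<close>
    have "a (j - 1) = i"
    proof (rule ccontr)
      assume "a (j - 1) \<noteq> i"
      then have "\<theta> (i - 1) = \<mu> j" "\<theta> (Suc i - 1) = \<mu> j"
        using jm j j0 m[of j i] m[of j "Suc i"] by auto
      then show False using ne by simp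
    qed
    moreover have "j - 1 \<noteq> 0" using \<open>a (j - 1) = i\<close> a i1 by (intro notI) simp
    ultimately show "i \<in> a ` {1..<k}" using j by (intro image_eqI[of _ _ "j - 1"]) auto
  qed
  then have "card (jumps n \<theta>) \<le> card (a ` {1..<k})" by (intro card_mono) auto
  also have "\<dots> \<le> k - 1" using card_image_le[of "{1..<k}" a] by simp
  finally show ?thesis .
qed

text \<open>Take \<open>a j\<close> to be the number of indices in the first \<open>j\<close> cells.
  Cell numbers increase with the index, so these indices form an initial segment; when there are
  fewer jumps than allowed, the remaining pieces are empty.\<close>

lemma ThetaI:
  assumes k: "1 \<le> k" and J: "card (jumps n \<theta>) \<le> k - 1"
  shows "\<theta> \<in> Theta n k"
proof -
  define g where "g = cell (jumps n \<theta>)"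
  define a where "a j = card {i. i < n \<and> g i < j}" for j
  have g_mono: "i \<le> j \<Longrightarrow> g i \<le> g j" for i j
    unfolding g_def by (rule cell_mono) auto
  have gk: "g i < k" for i
    using cell_le_card[of "jumps n \<theta>" i] J k by (simp add: g_def)
  have a_iff: "i < a j \<longleftrightarrow> g i < j" if "i < n" for i j
  proof
    assume "g i < j"
    then have "{..i} \<subseteq> {i. i < n \<and> g i < j}"
      using that by (auto intro: le_less_trans[OF g_mono])
    then have "card {..i} \<le> a j" unfolding a_def by (intro card_mono) auto
    then show "i < a j" by simp
  next
    assume ia: "i < a j"
    show "g i < j"
    proof (rule ccontr)
      assume "\<not> g i < j"
      then have "{i. i < n \<and> g i < j} \<subseteq> {..<i}"
        using g_mono by (auto simp: not_less) (meson leD le_trans not_le_imp_less)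
      then have "a j \<le> card {..<i}" unfolding a_def by (intro card_mono) auto
      then show False using ia by simp
    qed
  qed
  have an: "a j \<le> n" for j
    unfolding a_def using card_mono[of "{..<n}" "{i. i < n \<and> g i < j}"] by auto
  \<comment> \<open>Any index of the cell can represent it, since the vector is constant
    there.\<close>
  define \<mu> where "\<mu> j = \<theta> (SOME i. i < n \<and> g i = j - 1)" for j
  show ?thesis
    unfolding Theta_def
  proof (intro CollectI exI[of _ a] exI[of _ \<mu>] conjI ballI allI impI)
    show "a 0 = 0" by (simp add: a_def)
    show "a k = n" using gk by (simp add: a_def)
    show "a j \<le> a (Suc j)" for j
      unfolding a_def by (intro card_mono) auto
    fix j i assume j: "j \<in> {1..k}" and i: "a (j - 1) < i \<and> i \<le> a j"
    then have i1: "i - 1 < n" "i - 1 < a j" "\<not> i - 1 < a (j - 1)" using an[of j] by auto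
    then have gi: "g (i - 1) = j - 1" using a_iff[of "i - 1"] by auto
    have "\<exists>i. i < n \<and> g i = j - 1" using i1 gi by blast
    from someI_ex[OF this] obtain i0 where i0: "\<mu> j = \<theta> i0" "i0 < n" "g i0 = j - 1"
      unfolding \<mu>_def by blast
    have "\<theta> (i - 1) = \<theta> i0"
      by (rule constant_on_cell[of "jumps n \<theta>" n \<theta>]) (use i1 gi i0 in \<open>simp_all add: g_def\<close>)
    then show "\<theta> (i - 1) = \<mu> j" using i0 by simp
  qed
qed

lemma Theta_mono:
  assumes "1 \<le> j" "j \<le> k" shows "Theta n j \<subseteq> Theta n k"
proof
  fix \<theta> assume "\<theta> \<in> Theta n j"
  then show "\<theta> \<in> Theta n k" using ThetaD[of \<theta> n j] assms by (intro ThetaI) auto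
qed

section \<open>From detection to minimax lower bounds\<close>

lemma minimax_risk_geI:
  assumes "\<And>est. est \<in> estimators n \<Longrightarrow> a \<le> (SUP \<theta>\<in>Theta n k. risk n \<sigma> est \<theta>)"
  shows "a \<le> minimax_risk n k \<sigma>"
  unfolding minimax_risk_def using assms by (rule INF_greatest)

lemma minimax_risk_leI:
  assumes "est \<in> estimators n" "\<And>\<theta>. \<theta> \<in> Theta n k \<Longrightarrow> risk n \<sigma> est \<theta> \<le> a"
  shows "minimax_risk n k \<sigma> \<le> a"
  unfolding minimax_risk_def using assms(1) by (rule INF_lower2) (rule SUP_least[OF assms(2)])

text \<open>The null is the zero vector. Both the average risk over the alternatives and the null
  risk are at most the supremum, so \<open>r / 8\<close> is at most \<open>1 + K / 2\<close> times
  it.\<close>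

lemma detection_minimax:
  fixes v :: "'j \<Rightarrow> nat \<Rightarrow> real"
  assumes s: "0 < \<sigma>" and k: "1 \<le> k"
    and I: "finite I" "I \<noteq> {}" and r: "0 < r" and K: "0 < K"
    and norm: "\<And>j. j \<in> I \<Longrightarrow> (\<Sum>i<n. (v j i)\<^sup>2) = r"
    and chi: "(\<Sum>i\<in>I. \<Sum>j\<in>I. exp ((\<Sum>c<n. v i c * v j c) / \<sigma>\<^sup>2)) \<le> K * (real (card I))\<^sup>2"
    and Th: "\<And>j. j \<in> I \<Longrightarrow> v j \<in> Theta n k"
  shows "ennreal (r / (8 + 4 * K)) \<le> minimax_risk n k \<sigma>"
proof (rule minimax_risk_geI)
  fix est assume est: "est \<in> estimators n"
  let ?S = "SUP \<theta>\<in>Theta n k. risk n \<sigma> est \<theta>"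
  have N: "0 < card I" using I by (simp add: card_gt_0_iff)
  have z: "(\<lambda>_. 0) \<in> Theta n k" by (rule ThetaI[OF k]) (simp add: jumps_def)
  have "ennreal (r / 8) \<le> ennreal (1 / real (card I)) * (\<Sum>j\<in>I. prisk n \<sigma> {..<n} est (\<lambda>i. 0 + v j i))
     + ennreal (K / 2) * prisk n \<sigma> {..<n} est (\<lambda>_. 0)"
    by (rule detection_lower_bound[OF s est order_refl I r K norm chi])
  also have "\<dots> \<le> ennreal (1 / real (card I)) * (\<Sum>j\<in>I. ?S) + ennreal (K / 2) * ?S"
    using Th z by (intro add_mono mult_left_mono sum_mono) (auto simp: risk_eq_prisk[symmetric] intro: SUP_upper)
  also have "ennreal (1 / real (card I)) * (\<Sum>j\<in>I. ?S) = ?S"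
  proof -
    have "ennreal (1 / real (card I)) * (\<Sum>j\<in>I. ?S) = (ennreal (1 / real (card I)) * ennreal (real (card I))) * ?S"
      by (simp add: ennreal_of_nat_eq_real_of_nat mult.assoc)
    also have "ennreal (1 / real (card I)) * ennreal (real (card I)) = 1"
      using N by (simp add: ennreal_mult[symmetric])
    finally show ?thesis by simp
  qed
  also have "?S + ennreal (K / 2) * ?S = ennreal (1 + K / 2) * ?S"
    using K by (simp add: ennreal_plus distrib_right)
  finally have *: "ennreal (r / 8) \<le> ennreal (1 + K / 2) * ?S" .
  have "ennreal (r / (8 + 4 * K)) = ennreal (1 / (1 + K / 2)) * ennreal (r / 8)"
    using K r by (simp add: ennreal_mult[symmetric] field_simps)
  also have "\<dots> \<le> ennreal (1 / (1 + K / 2)) * (ennreal (1 + K / 2) * ?S)"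
    by (intro mult_left_mono *) auto
  also have "\<dots> = ?S"
    using K by (simp add: mult.assoc[symmetric] ennreal_mult[symmetric] del: ennreal_plus)
  finally show "ennreal (r / (8 + 4 * K)) \<le> ?S" .
qed

text \<open>A single constant alternative of norm \<open>\<sigma>\<close> has second moment
  \<open>exp 1\<close>, which is at most 3; this gives the denominator 8 + 4 * 3 = 20.\<close>

lemma minimax_lower_constant:
  assumes s: "0 < \<sigma>" and n: "1 \<le> n" and k: "1 \<le> k"
  shows "ennreal (\<sigma>\<^sup>2 / 20) \<le> minimax_risk n k \<sigma>"
proof -
  define v where "v = (\<lambda>(_::unit) (_::nat). \<sigma> / sqrt (real n))"
  have "ennreal (\<sigma>\<^sup>2 / (8 + 4 * 3)) \<le> minimax_risk n k \<sigma>"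
  proof (rule detection_minimax[where I = "UNIV :: unit set" and v = v])
    have "v u \<in> Theta n 1" for u by (rule ThetaI) (auto simp: jumps_def v_def)
    then show "v u \<in> Theta n k" for u using Theta_mono[of 1 k n] k by auto
    have eq: "(\<Sum>c<n. v i c * v j c) = \<sigma>\<^sup>2" for i j
      using n by (simp add: v_def power2_eq_square)
    then show "(\<Sum>i<n. (v j i)\<^sup>2) = \<sigma>\<^sup>2" for j by (simp add: power2_eq_square)
    show "(\<Sum>i\<in>(UNIV :: unit set). \<Sum>j\<in>(UNIV :: unit set). exp ((\<Sum>c<n. v i c * v j c) / \<sigma>\<^sup>2)) \<le> 3 * (real (card (UNIV :: unit set)))\<^sup>2"
      unfolding eq using s exp_le by (simp add: UNIV_unit)
  qed (use s k in auto)
  then show ?thesis by simp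
qed

text \<open>Splitting at \<open>i\<close> leaves two geometric series, each at most 2.\<close>

lemma sum_half_powers_le: "(\<Sum>j<N. (1 / 2 :: real) ^ (if i \<le> j then j - i else i - j)) \<le> 4"
proof -
  have g: "(\<Sum>j<M. (1 / 2 :: real) ^ j) \<le> 2" for M :: nat
    by (simp add: sum_gp_strict)
  have "(\<Sum>j<N. (1 / 2 :: real) ^ (if i \<le> j then j - i else i - j))
    \<le> (\<Sum>j<i + N. (1 / 2 :: real) ^ (if i \<le> j then j - i else i - j))"
    by (rule sum_mono2) auto
  also have "\<dots> = (\<Sum>j<i. (1 / 2) ^ (i - j)) + (\<Sum>j<N. (1 / 2) ^ j)"
  proof -
    have "(\<Sum>j = i..<i + N. (1 / 2 :: real) ^ (j - i)) = (\<Sum>j<N. (1 / 2) ^ j)"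
      using sum.shift_bounds_nat_ivl[of "\<lambda>j. (1 / 2 :: real) ^ (j - i)" 0 i N]
      by (simp add: lessThan_atLeast0 add.commute)
    moreover have "(\<Sum>j<i + N. (1 / 2 :: real) ^ (if i \<le> j then j - i else i - j))
      = (\<Sum>j = 0..<i. (1 / 2) ^ (if i \<le> j then j - i else i - j)) + (\<Sum>j = i..<i + N. (1 / 2) ^ (if i \<le> j then j - i else i - j))"
      unfolding lessThan_atLeast0 by (rule sum.atLeastLessThan_concat[symmetric]) auto
    ultimately show ?thesis by (simp add: lessThan_atLeast0)
  qed
  also have "(\<Sum>j<i. (1 / 2 :: real) ^ (i - j)) \<le> (\<Sum>j<Suc i. (1 / 2) ^ j)"
  proof -
    have "(\<Sum>j<i. (1 / 2 :: real) ^ (i - j)) = (\<Sum>j<i. (1 / 2) ^ (Suc j))"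
      by (subst sum.nat_diff_reindex[symmetric]) (auto intro!: sum.cong simp: Suc_diff_Suc)
    also have "\<dots> \<le> (\<Sum>j<Suc i. (1 / 2) ^ j)"
      by (subst sum.lessThan_Suc_shift) simp
    finally show ?thesis .
  qed
  also have "\<dots> + (\<Sum>j<N. (1 / 2 :: real) ^ j) \<le> 2 + 2" by (intro add_mono g)
  finally show ?thesis by simp
qed

text \<open>All \<open>N\<close> alternatives have squared norm \<open>r\<close>, and their inner
  products decay geometrically in the distance of their scales. Hence the pairwise exponentials
  average to at most 5, and 2 * (8 + 4 * 5) = 56.\<close>

lemma minimax_lower_two_pieces_dyadic:
  assumes s: "0 < \<sigma>" and N: "2 \<le> N" "4 ^ (N - 1) \<le> n"
  shows "ennreal (\<sigma>\<^sup>2 * ln (real N) / 56) \<le> minimax_risk n 2 \<sigma>"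
proof -
  define w where "w = ln (real N) / 2"
  have w: "0 < w" using N by (simp add: w_def)
  define r where "r = \<sigma>\<^sup>2 * w"
  have r: "0 < r" using s w by (simp add: r_def)
  define v where "v j i = (if i < 4 ^ j then sqrt r / 2 ^ j else 0)" for j i :: nat
  have len: "4 ^ j \<le> n" if "j < N" for j :: nat
  proof -
    have "(4::nat) ^ j \<le> 4 ^ (N - 1)" by (rule power_increasing) (use that in auto)
    then show ?thesis using N(2) by linarith
  qed
  have ip: "(\<Sum>c<n. v i c * v j c) = r * (1 / 2) ^ (if i \<le> j then j - i else i - j)"
    if "i < N" "j < N" for i j
  proof -
    have *: "(\<Sum>c<n. v i c * v j c) = r * (1 / 2) ^ (j - i)" if "i \<le> j" "j < N" for i j
    proof -
      have "(\<Sum>c<n. v i c * v j c) = (\<Sum>c<(4::nat) ^ i. sqrt r / 2 ^ i * (sqrt r / 2 ^ j))"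
        using len[of i] that order_less_le_trans[OF _ power_increasing[of i j "4::nat"]]
        by (intro sum.mono_neutral_cong_right) (auto simp: v_def)
      also have "\<dots> = r * (2 ^ i * 2 ^ i / (2 ^ i * 2 ^ j))"
        using r by (simp add: power_mult_distrib[symmetric])
      also have "\<dots> = r * (1 / 2) ^ (j - i)"
        using that by (simp add: power_diff power_divide)
      finally show ?thesis .
    qed
    show ?thesis using *[of i j] *[of j i] that by (auto simp: mult.commute)
  qed
  \<comment> \<open>A bound linear in \<open>q\<close> lets the geometric row sums be used. The
    value \<open>w = ln N / 2\<close> is chosen so that \<open>exp w * exp w = N\<close>, which
    balances the second term against the first after summation.\<close>
  have ex: "exp (w * q) \<le> 1 + q * real N" if "0 \<le> q" "q \<le> 1" for q
  proof -
    have "1 - w * q \<le> exp (- (w * q))" using exp_ge_add_one_self[of "- (w * q)"] by simp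
    then have "exp (w * q) * (1 - w * q) \<le> exp (w * q) * exp (- (w * q))" by (intro mult_left_mono) auto
    then have "exp (w * q) \<le> 1 + q * (w * exp (w * q))" by (simp add: exp_minus algebra_simps)
    also have "\<dots> \<le> 1 + q * (exp w * exp w)"
    proof -
      have "w \<le> exp w" using exp_ge_add_one_self[of w] by linarith
      then show ?thesis
        using that w mult_left_mono[of q 1 w] by (intro add_left_mono mult_left_mono mult_mono) auto
    qed
    also have "exp w * exp w = real N"
      using N by (simp add: w_def exp_add[symmetric])
    finally show ?thesis .
  qed
  have "ennreal (r / (8 + 4 * 5)) \<le> minimax_risk n 2 \<sigma>"
  proof (rule detection_minimax[where I = "{..<N}" and v = v])
    show "(\<Sum>i<n. (v j i)\<^sup>2) = r" if "j \<in> {..<N}" for j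
      using ip[of j j] that by (simp add: power2_eq_square)
    show "v j \<in> Theta n 2" if "j \<in> {..<N}" for j
    proof (rule ThetaI)
      have "jumps n (v j) \<subseteq> {4 ^ j}" by (auto simp: jumps_def v_def split: if_splits)
      then have "card (jumps n (v j)) \<le> card {4 ^ j :: nat}" by (intro card_mono) auto
      then show "card (jumps n (v j)) \<le> 2 - 1" by simp
    qed simp
    have "(\<Sum>i<N. \<Sum>j<N. exp ((\<Sum>c<n. v i c * v j c) / \<sigma>\<^sup>2))
      \<le> (\<Sum>i<N. \<Sum>j<N. 1 + (1 / 2) ^ (if i \<le> j then j - i else i - j) * real N)"
    proof (intro sum_mono)
      fix i j assume ij: "i \<in> {..<N}" "j \<in> {..<N}"
      define q :: real where "q = (1 / 2) ^ (if i \<le> j then j - i else i - j)"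
      have "(\<Sum>c<n. v i c * v j c) / \<sigma>\<^sup>2 = w * q"
        using ij s by (simp add: ip r_def q_def)
      then show "exp ((\<Sum>c<n. v i c * v j c) / \<sigma>\<^sup>2) \<le> 1 + (1 / 2) ^ (if i \<le> j then j - i else i - j) * real N"
        using ex[of q] by (simp add: q_def power_le_one)
    qed
    also have "\<dots> = (\<Sum>i<N. real N + real N * (\<Sum>j<N. (1 / 2) ^ (if i \<le> j then j - i else i - j)))"
      by (simp add: sum.distrib sum_distrib_left mult.commute)
    also have "\<dots> \<le> (\<Sum>i<N. real N + real N * 4)"
      by (intro sum_mono add_left_mono mult_left_mono sum_half_powers_le) auto
    also have "\<dots> = 5 * (real (card {..<N}))\<^sup>2" by (simp add: power2_eq_square)
    finally show "(\<Sum>i\<in>{..<N}. \<Sum>j\<in>{..<N}. exp ((\<Sum>c<n. v i c * v j c) / \<sigma>\<^sup>2)) \<le> 5 * (real (card {..<N}))\<^sup>2" .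
  qed (use s r N in \<open>auto simp: lessThan_empty_iff\<close>)
  then show ?thesis by (simp add: r_def w_def)
qed

lemma minimax_lower_two_pieces:
  assumes s: "0 < \<sigma>" and n: "2 \<le> n"
  shows "ennreal (\<sigma>\<^sup>2 * ln (ln (16 * real n)) / 240) \<le> minimax_risk n 2 \<sigma>"
proof -
  have "\<exists>m. 4 ^ m \<le> n \<and> n < 4 ^ (m + 1)"
    by (rule ex_power_ivl1) (use n in auto)
  then obtain m where m: "4 ^ m \<le> n" "n < 4 ^ (m + 1)" by blast
  have "real n < real (4 ^ (m + 1))" using m(2) by (simp only: of_nat_less_iff)
  then have "16 * real n \<le> 16 * 4 ^ (m + 1)" by simp
  then have "ln (16 * real n) \<le> ln (16 * 4 ^ (m + 1))"
    using n by (subst ln_le_cancel_iff) auto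
  also have "16 * 4 ^ (m + 1) = (4::real) ^ (m + 3)" by (simp add: power_add)
  also have "ln \<dots> = real (m + 3) * ln 4" by (rule ln_realpow)
  also have "\<dots> \<le> real (m + 3) * 2"
  proof (rule mult_left_mono)
    have "ln 4 = 2 * ln (2::real)" using ln_realpow[of 2 2] by simp
    then show "ln 4 \<le> (2::real)" using ln_2_less_1 by linarith
  qed simp
  also have "\<dots> \<le> 6 * real (m + 1)" by simp
  finally have l1: "ln (16 * real n) \<le> 6 * real (m + 1)" .
  have "ln (ln (16 * real n)) \<le> ln (6 * real (m + 1))"
    using l1 n by (subst ln_le_cancel_iff) auto
  also have "\<dots> = ln 6 + ln (real (m + 1))" by (rule ln_mult_pos) auto
  also have "ln 6 \<le> (3::real)"
  proof -
    have "ln 6 \<le> ln ((2::real) ^ 3)" by (subst ln_le_cancel_iff) auto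
    also have "\<dots> = 3 * ln 2" by (subst ln_realpow) simp
    finally show ?thesis using ln2_le_25_over_36 by linarith
  qed
  finally have l2: "ln (ln (16 * real n)) \<le> 3 + ln (real (m + 1))" by simp
  have c: "ennreal (\<sigma>\<^sup>2 / 20) \<le> minimax_risk n 2 \<sigma>"
    by (rule minimax_lower_constant) (use s n in auto)
  show ?thesis
  \<comment> \<open>For small \<open>m\<close> the iterated logarithm is bounded and the constant
    alternative suffices. Otherwise \<open>ln (m + 1)\<close> absorbs the additive 3, and 4 * 56 <=
    240.\<close>
  proof (cases "ln (real (m + 1)) \<le> 1")
    case True
    have "ennreal (\<sigma>\<^sup>2 * ln (ln (16 * real n)) / 240) \<le> ennreal (\<sigma>\<^sup>2 / 20)"
    proof (rule ennreal_leI)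
      have "\<sigma>\<^sup>2 * ln (ln (16 * real n)) \<le> \<sigma>\<^sup>2 * 12"
        using True l2 by (intro mult_left_mono) auto
      then show "\<sigma>\<^sup>2 * ln (ln (16 * real n)) / 240 \<le> \<sigma>\<^sup>2 / 20" by simp
    qed
    then show ?thesis using c by (rule order_trans)
  next
    case False
    then have m1: "1 \<le> m" by (cases m) auto
    have "ennreal (\<sigma>\<^sup>2 * ln (ln (16 * real n)) / 240) \<le> ennreal (\<sigma>\<^sup>2 * ln (real (m + 1)) / 56)"
    proof (rule ennreal_leI)
      have "\<sigma>\<^sup>2 * ln (ln (16 * real n)) \<le> \<sigma>\<^sup>2 * (4 * ln (real (m + 1)))"
        using False l2 by (intro mult_left_mono) auto
      moreover have "0 \<le> \<sigma>\<^sup>2 * ln (real (m + 1))" by (auto intro: mult_nonneg_nonneg)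
      ultimately show "\<sigma>\<^sup>2 * ln (ln (16 * real n)) / 240 \<le> \<sigma>\<^sup>2 * ln (real (m + 1)) / 56" by argo
    qed
    also have "\<dots> \<le> minimax_risk n 2 \<sigma>"
      by (rule minimax_lower_two_pieces_dyadic[OF s]) (use m m1 in auto)
    finally show ?thesis .
  qed
qed

section \<open>Spike lower bound\<close>

text \<open>Block \<open>b < s\<close> has length \<open>m\<close>; a value \<open>g b \<ge> m\<close> encodes that it carries no spike,
  so a uniform \<open>g b < 2 * m\<close> puts mass one half on the null.\<close>

definition spikes :: "nat \<Rightarrow> nat \<Rightarrow> real \<Rightarrow> (nat \<Rightarrow> nat) \<Rightarrow> nat \<Rightarrow> real" where
  "spikes s m \<tau> g i = (if i div m < s \<and> g (i div m) < m \<and> i mod m = g (i div m) then \<tau> else 0)"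

text \<open>Each block contributes at most two jumps, one at its spike and one right after
  it.\<close>

lemma spikes_Theta:
  assumes "1 \<le> k" "2 * s \<le> k - 1"
  shows "spikes s m \<tau> g \<in> Theta n k"
proof (rule ThetaI[OF assms(1)])
  let ?J = "(\<lambda>b. b * m + g b) ` {..<s} \<union> (\<lambda>b. Suc (b * m + g b)) ` {..<s}"
  have nz: "i \<in> (\<lambda>b. b * m + g b) ` {..<s}" if "spikes s m \<tau> g i \<noteq> 0" for i
  proof (rule image_eqI[of _ _ "i div m"])
    show "i = i div m * m + g (i div m)" "i div m \<in> {..<s}"
      using that div_mult_mod_eq[of i m] unfolding spikes_def by (metis, metis lessThan_iff)
  qed
  have "jumps n (spikes s m \<tau> g) \<subseteq> ?J"
  proof
    fix i assume "i \<in> jumps n (spikes s m \<tau> g)"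
    then have i: "1 \<le> i" "spikes s m \<tau> g i \<noteq> spikes s m \<tau> g (i - 1)" by (auto simp: jumps_def)
    then consider "spikes s m \<tau> g i \<noteq> 0" | "spikes s m \<tau> g (i - 1) \<noteq> 0" by metis
    then show "i \<in> ?J"
    proof cases
      case 2
      from nz[OF this] have "Suc (i - 1) \<in> (\<lambda>b. Suc (b * m + g b)) ` {..<s}" by blast
      then show ?thesis using i(1) by simp
    qed (use nz in blast)
  qed
  then have "card (jumps n (spikes s m \<tau> g)) \<le> card ?J" by (intro card_mono) auto
  also have "\<dots> \<le> card ((\<lambda>b. b * m + g b) ` {..<s}) + card ((\<lambda>b. Suc (b * m + g b)) ` {..<s})"
    by (rule card_Un_le)
  also have "\<dots> \<le> s + s"
    using card_image_le[of "{..<s}" "\<lambda>b. b * m + g b"] card_image_le[of "{..<s}" "\<lambda>b. Suc (b * m + g b)"] by simp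
  finally show "card (jumps n (spikes s m \<tau> g)) \<le> k - 1" using assms(2) by simp
qed

text \<open>The value \<open>m\<close> empties block \<open>b\<close>, so a configuration splits
  into a background plus one coordinate, the form \<open>t + v\<close> required by the detection
  bound.\<close>

lemma spikes_upd:
  assumes b: "b < s" and p: "p < m"
  shows "spikes s m \<tau> (g(b := p)) = (\<lambda>i. spikes s m \<tau> (g(b := m)) i + (if i = b * m + p then \<tau> else 0))"
proof
  fix i
  have "i = b * m + p \<longleftrightarrow> i div m = b \<and> i mod m = p"
    using p div_mult_mod_eq[of i m] by auto
  then show "spikes s m \<tau> (g(b := p)) i = spikes s m \<tau> (g(b := m)) i + (if i = b * m + p then \<tau> else 0)"
    using b p by (auto simp: spikes_def)
qed

lemma spikes_upd_null: "m \<le> p \<Longrightarrow> spikes s m \<tau> (g(b := p)) = spikes s m \<tau> (g(b := m))"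
  by (auto simp: spikes_def fun_eq_iff)

lemma sum_PiE_resample:
  fixes F :: "(nat \<Rightarrow> nat) \<Rightarrow> 'a :: comm_semiring_1"
  assumes b: "b \<in> B"
  shows "(\<Sum>g\<in>B \<rightarrow>\<^sub>E Q. \<Sum>p\<in>Q. F (g(b := p))) = of_nat (card Q) * (\<Sum>g\<in>B \<rightarrow>\<^sub>E Q. F g)"
proof -
  \<comment> \<open>Swapping the resampled value with the old one is an involution.\<close>
  let ?f = "\<lambda>(g :: nat \<Rightarrow> nat, p). (g(b := p), g b)"
  have "(\<Sum>g\<in>B \<rightarrow>\<^sub>E Q. \<Sum>p\<in>Q. F (g(b := p))) = (\<Sum>(g, p)\<in>(B \<rightarrow>\<^sub>E Q) \<times> Q. F (g(b := p)))"
    by (rule sum.cartesian_product)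
  also have "\<dots> = (\<Sum>(g, p)\<in>(B \<rightarrow>\<^sub>E Q) \<times> Q. F g)"
    by (rule sum.reindex_bij_witness[where i = ?f and j = ?f])
       (use b in \<open>auto simp: PiE_iff extensional_def split: if_splits\<close>)
  also have "\<dots> = (\<Sum>g\<in>B \<rightarrow>\<^sub>E Q. \<Sum>p\<in>Q. F g)"
    by (rule sum.cartesian_product[symmetric])
  also have "\<dots> = of_nat (card Q) * (\<Sum>g\<in>B \<rightarrow>\<^sub>E Q. F g)"
    by (simp add: sum_distrib_left)
  finally show ?thesis .
qed

text \<open>The \<open>m\<close> single spikes are orthogonal and
  \<open>exp (\<tau>\<^sup>2 / \<sigma>\<^sup>2) = m\<close>, so the second moment is at most 2.
  With \<open>K = 2\<close> the null carries the same total weight as all spikes together, matching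
  the \<open>m\<close> values of \<open>p\<close> that encode an empty block.\<close>

lemma spike_block_bound:
  assumes s: "0 < \<sigma>" and est: "est \<in> estimators n" and b: "b < B" and m: "2 \<le> m" and n: "B * m \<le> n"
  defines "\<tau> \<equiv> \<sigma> * sqrt (ln (real m))" and "P \<equiv> {b * m..<b * m + m}"
  shows "ennreal (real m * (\<sigma>\<^sup>2 * ln (real m)) / 8) \<le> (\<Sum>p<2 * m. prisk n \<sigma> P est (spikes B m \<tau> (g(b := p))))"
proof -
  define t where "t = spikes B m \<tau> (g(b := m))"
  define v :: "nat \<Rightarrow> nat \<Rightarrow> real" where "v p i = (if i = b * m + p then \<tau> else 0)" for p i
  have bm: "b * m + m \<le> n"
  proof -
    have "Suc b * m \<le> B * m" using b by (intro mult_le_mono1) simp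
    then show ?thesis using n by simp
  qed
  have lm: "0 < ln (real m)" using m by simp
  have t2: "\<tau>\<^sup>2 = \<sigma>\<^sup>2 * ln (real m)" using lm by (simp add: \<tau>_def power_mult_distrib)
  have ip: "(\<Sum>c<n. v p c * v q c) = (if p = q then \<tau>\<^sup>2 else 0)" if "p < m" for p q
  proof -
    have "(\<Sum>c<n. v p c * v q c) = (\<Sum>c<n. if c = b * m + p then (if p = q then \<tau>\<^sup>2 else 0) else 0)"
      by (intro sum.cong) (auto simp: v_def power2_eq_square)
    then show ?thesis using that bm by (simp add: sum.delta')
  qed
  have "ennreal (\<tau>\<^sup>2 / 8) \<le> ennreal (1 / real (card {..<m})) * (\<Sum>p\<in>{..<m}. prisk n \<sigma> P est (\<lambda>i. t i + v p i))
     + ennreal (2 / 2) * prisk n \<sigma> P est t"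
  proof (rule detection_lower_bound[OF s est])
    show "P \<subseteq> {..<n}" using bm by (auto simp: P_def)
    show "0 < \<tau>\<^sup>2" using t2 s lm by simp
    show "(\<Sum>i\<in>P. (v p i)\<^sup>2) = \<tau>\<^sup>2" if "p \<in> {..<m}" for p
    proof -
      have "(\<Sum>i\<in>P. (v p i)\<^sup>2) = (\<Sum>i\<in>P. if i = b * m + p then \<tau>\<^sup>2 else 0)"
        by (intro sum.cong) (auto simp: v_def)
      then show ?thesis using that by (simp add: P_def sum.delta')
    qed
    have "(\<Sum>p<m. \<Sum>q<m. exp ((\<Sum>c<n. v p c * v q c) / \<sigma>\<^sup>2)) \<le> (\<Sum>p<m. \<Sum>q<m. 1 + (if p = q then real m else 0))"
    proof (intro sum_mono)
      fix p q assume "p \<in> {..<m}" "q \<in> {..<m}"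
      then show "exp ((\<Sum>c<n. v p c * v q c) / \<sigma>\<^sup>2) \<le> 1 + (if p = q then real m else 0)"
        using m s by (simp add: ip t2)
    qed
    also have "\<dots> = 2 * (real (card {..<m}))\<^sup>2"
      by (simp add: sum.distrib power2_eq_square)
    finally show "(\<Sum>p\<in>{..<m}. \<Sum>q\<in>{..<m}. exp ((\<Sum>c<n. v p c * v q c) / \<sigma>\<^sup>2)) \<le> 2 * (real (card {..<m}))\<^sup>2" .
  qed (use m in \<open>auto simp: lessThan_empty_iff\<close>)
  then have *: "ennreal (\<tau>\<^sup>2 / 8) \<le> ennreal (1 / real m) * (\<Sum>p<m. prisk n \<sigma> P est (\<lambda>i. t i + v p i)) + prisk n \<sigma> P est t"
    by simp
  have "ennreal (real m * (\<sigma>\<^sup>2 * ln (real m)) / 8) = ennreal (real m) * ennreal (\<tau>\<^sup>2 / 8)"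
    unfolding t2 using lm by (simp add: ennreal_mult''[symmetric])
  also have "\<dots> \<le> ennreal (real m) * (ennreal (1 / real m) * (\<Sum>p<m. prisk n \<sigma> P est (\<lambda>i. t i + v p i)) + prisk n \<sigma> P est t)"
    by (intro mult_left_mono *) auto
  also have "\<dots> = (\<Sum>p<m. prisk n \<sigma> P est (\<lambda>i. t i + v p i)) + of_nat m * prisk n \<sigma> P est t"
    using m by (simp add: distrib_left mult.assoc[symmetric] ennreal_mult[symmetric] ennreal_of_nat_eq_real_of_nat)
  also have "(\<Sum>p<m. prisk n \<sigma> P est (\<lambda>i. t i + v p i)) = (\<Sum>p<m. prisk n \<sigma> P est (spikes B m \<tau> (g(b := p))))"
  proof (rule sum.cong[OF refl])
    fix p assume "p \<in> {..<m}"
    then have "spikes B m \<tau> (g(b := p)) = (\<lambda>i. t i + v p i)"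
      unfolding t_def v_def using spikes_upd[OF b] by blast
    then show "prisk n \<sigma> P est (\<lambda>i. t i + v p i) = prisk n \<sigma> P est (spikes B m \<tau> (g(b := p)))" by simp
  qed
  also have "of_nat m * prisk n \<sigma> P est t = (\<Sum>p\<in>{m..<2 * m}. prisk n \<sigma> P est (spikes B m \<tau> (g(b := p))))"
  proof -
    have "(\<Sum>p\<in>{m..<2 * m}. prisk n \<sigma> P est (spikes B m \<tau> (g(b := p)))) = (\<Sum>p\<in>{m..<2 * m}. prisk n \<sigma> P est t)"
      unfolding t_def by (intro sum.cong refl arg_cong[where f = "prisk n \<sigma> P est"] spikes_upd_null) simp
    then show ?thesis by simp
  qed
  also have "(\<Sum>p<m. prisk n \<sigma> P est (spikes B m \<tau> (g(b := p)))) + \<dots> = (\<Sum>p<2 * m. prisk n \<sigma> P est (spikes B m \<tau> (g(b := p))))"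
    unfolding lessThan_atLeast0 by (rule sum.atLeastLessThan_concat) auto
  finally show ?thesis .
qed

lemma sum_prisk_blocks_le:
  assumes est: "est \<in> estimators n" and n: "B * m \<le> n"
  shows "(\<Sum>b<B. prisk n \<sigma> {b * m..<b * m + m} est \<theta>) \<le> risk n \<sigma> est \<theta>"
proof -
  have sub: "{b * m..<b * m + m} \<subseteq> {..<n}" if "b < B" for b
  proof -
    have "Suc b * m \<le> B * m" using that by (intro mult_le_mono1) simp
    then show ?thesis using n by auto
  qed
  have "(\<Sum>b<B. prisk n \<sigma> {b * m..<b * m + m} est \<theta>)
    = (\<integral>\<^sup>+ x. (\<Sum>b<B. ennreal (\<Sum>i\<in>{b * m..<b * m + m}. (est x i - \<theta> i)\<^sup>2)) \<partial>gauss n \<sigma> \<theta>)"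
    unfolding prisk_def
  proof (rule nn_integral_sum[symmetric])
    fix b assume "b \<in> {..<B}"
    then show "(\<lambda>x. ennreal (\<Sum>i\<in>{b * m..<b * m + m}. (est x i - \<theta> i)\<^sup>2)) \<in> borel_measurable (gauss n \<sigma> \<theta>)"
      using measurable_ploss[OF est sub, of b \<theta>] by (simp add: measurable_cong_sets[OF sets_gauss refl])
  qed
  also have "\<dots> \<le> risk n \<sigma> est \<theta>"
    unfolding risk_def
  proof (rule nn_integral_mono)
    fix x
    have "(\<Sum>b<B. \<Sum>i\<in>{b * m..<b * m + m}. (est x i - \<theta> i)\<^sup>2) = (\<Sum>i\<in>(\<Union>b<B. {b * m..<b * m + m}). (est x i - \<theta> i)\<^sup>2)"
    proof (rule sum.UNION_disjoint[symmetric])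
      show "\<forall>b\<in>{..<B}. \<forall>c\<in>{..<B}. b \<noteq> c \<longrightarrow> {b * m..<b * m + m} \<inter> {c * m..<c * m + m} = {}"
      proof (intro ballI impI)
        fix b c :: nat assume "b \<noteq> c"
        moreover have "i div m = d" if "i \<in> {d * m..<d * m + m}" for i d
          using that by (auto intro!: div_nat_eqI simp: mult.commute)
        ultimately show "{b * m..<b * m + m} \<inter> {c * m..<c * m + m} = {}" by blast
      qed
    qed auto
    also have "\<dots> \<le> (\<Sum>i<n. (est x i - \<theta> i)\<^sup>2)"
      using sub by (intro sum_mono2) auto
    finally show "(\<Sum>b<B. ennreal (\<Sum>i\<in>{b * m..<b * m + m}. (est x i - \<theta> i)\<^sup>2)) \<le> ennreal (\<Sum>i<n. (est x i - \<theta> i)\<^sup>2)"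
      by (simp add: sum_nonneg ennreal_leI)
  qed
  finally show ?thesis .
qed

text \<open>A Bayes argument with all configurations equally likely. For each block the bound holds
  conditionally on the other blocks, and the block risks add up inside the full risk. Dividing by
  the \<open>2 * m\<close> resampled values gives the constant 16.\<close>

lemma minimax_lower_spikes:
  assumes s: "0 < \<sigma>" and k: "1 \<le> k" "2 * B \<le> k - 1" and m: "2 \<le> m" and n: "B * m \<le> n"
  shows "ennreal (real B * (\<sigma>\<^sup>2 * ln (real m)) / 16) \<le> minimax_risk n k \<sigma>"
proof (rule minimax_risk_geI)
  fix est assume est: "est \<in> estimators n"
  let ?S = "SUP \<theta>\<in>Theta n k. risk n \<sigma> est \<theta>"
  define \<tau> where "\<tau> = \<sigma> * sqrt (ln (real m))"
  define L where "L = \<sigma>\<^sup>2 * ln (real m)"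
  have L: "0 \<le> L" using m by (simp add: L_def)
  define \<Gamma> where "\<Gamma> = {..<B} \<rightarrow>\<^sub>E {..<2 * m}"
  define F where "F b g = prisk n \<sigma> {b * m..<b * m + m} est (spikes B m \<tau> g)" for b g
  have fin: "finite \<Gamma>" by (simp add: \<Gamma>_def finite_PiE)
  have c: "0 < card \<Gamma>" using m by (auto simp: \<Gamma>_def card_PiE)
  have "ennreal (2 * real m * (real (card \<Gamma>) * (real B * L / 16)))
     = (\<Sum>b<B. \<Sum>g\<in>\<Gamma>. ennreal (real m * L / 8))"
    using L by (simp add: ennreal_of_nat_eq_real_of_nat ennreal_mult[symmetric] field_simps)
  also have "\<dots> \<le> (\<Sum>b<B. \<Sum>g\<in>\<Gamma>. \<Sum>p<2 * m. F b (g(b := p)))"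
    unfolding F_def L_def \<tau>_def by (intro sum_mono spike_block_bound[OF s est _ m n]) simp
  \<comment> \<open>Redrawing block \<open>b\<close> of a uniform configuration leaves the uniform
    law unchanged.\<close>
  also have "\<dots> = (\<Sum>b<B. of_nat (2 * m) * (\<Sum>g\<in>\<Gamma>. F b g))"
    unfolding \<Gamma>_def by (intro sum.cong refl) (subst sum_PiE_resample, auto)
  also have "\<dots> = of_nat (2 * m) * (\<Sum>g\<in>\<Gamma>. \<Sum>b<B. F b g)"
    by (simp add: sum_distrib_left[symmetric] sum.swap[of _ "{..<B}"])
  also have "\<dots> \<le> of_nat (2 * m) * (\<Sum>g\<in>\<Gamma>. ?S)"
    unfolding F_def
    by (intro mult_left_mono sum_mono order_trans[OF sum_prisk_blocks_le[OF est n]] SUP_upper spikes_Theta k) auto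
  also have "\<dots> = ennreal (2 * real m * real (card \<Gamma>)) * ?S"
    by (simp add: ennreal_of_nat_eq_real_of_nat ennreal_mult mult.assoc)
  finally have *: "ennreal (2 * real m * (real (card \<Gamma>) * (real B * L / 16))) \<le> ennreal (2 * real m * real (card \<Gamma>)) * ?S" .
  define q where "q = 2 * real m * real (card \<Gamma>)"
  have q: "0 < q" using m c by (simp add: q_def)
  have "ennreal (real B * L / 16) = ennreal (1 / q) * ennreal (q * (real B * L / 16))"
    using q L by (simp add: ennreal_mult[symmetric])
  also have "\<dots> \<le> ennreal (1 / q) * (ennreal q * ?S)"
    using * by (intro mult_left_mono) (auto simp: q_def mult.assoc)
  also have "\<dots> = ?S"
    using q by (simp add: mult.assoc[symmetric] ennreal_mult[symmetric])
  finally show "ennreal (real B * (\<sigma>\<^sup>2 * ln (real m)) / 16) \<le> ?S" by (simp add: L_def)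
qed

lemma minimax_lower_many_pieces:
  assumes s: "0 < \<sigma>" and k: "3 \<le> k" "k \<le> n"
  shows "ennreal (\<sigma>\<^sup>2 * real k * ln (exp 1 * real n / real k) / 192) \<le> minimax_risk n k \<sigma>"
proof -
  define B where "B = (k - 1) div 2"
  define m where "m = n div B"
  have B: "1 \<le> B" "2 * B \<le> k - 1" "2 * B \<le> n" "k \<le> 4 * B"
    using k unfolding B_def by presburger+
  have m: "2 \<le> m" using B by (simp add: m_def less_eq_div_iff_mult_less_eq mult.commute)
  have n: "B * m \<le> n" by (simp add: m_def)
  \<comment> \<open>Since \<open>2 * B \<le> k\<close>, rounding down in \<open>n div B\<close> is
    harmless: doubling this inequality yields \<open>n \<le> k * m\<close>.\<close>
  have "n < B * Suc m" using B dividend_less_times_div[of B n] by (simp add: m_def)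
  then have "2 * n < 2 * B * Suc m" by simp
  also have "\<dots> \<le> k * Suc m" using B by (intro mult_le_mono1) simp
  finally have "2 * n \<le> k * m + n" using k(2) by simp
  then have "n \<le> k * m" by simp
  then have "real n \<le> real (k * m)" by (simp only: of_nat_le_iff)
  then have "real n \<le> real k * real m" by simp
  then have "real n / real k \<le> real m" using k by (simp add: divide_le_eq mult.commute)
  then have l: "ln (real n / real k) \<le> ln (real m)" using k m by (subst ln_le_cancel_iff) auto
  have "ln 2 \<le> ln (real m)" using m by (subst ln_le_cancel_iff) auto
  then have "1 \<le> 2 * ln (real m)" using ln2_ge_two_thirds by linarith
  moreover have "ln (exp 1 * (real n / real k)) = 1 + ln (real n / real k)"
    using k by (subst ln_mult_pos) auto
  moreover have "0 \<le> ln (real n / real k)" using k by (intro ln_ge_zero) auto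
  \<comment> \<open>As \<open>m\<close> is at least 2, the additive 1 is at most
    \<open>2 * ln m\<close>. Together with \<open>k \<le> 4 * B\<close> the loss is 4 * 3 * 16 =
    192.\<close>
  ultimately have l3: "ln (exp 1 * real n / real k) \<le> 3 * ln (real m)"
    and l4: "0 \<le> ln (exp 1 * real n / real k)" using l unfolding times_divide_eq_right by linarith+
  have "ennreal (\<sigma>\<^sup>2 * real k * ln (exp 1 * real n / real k) / 192) \<le> ennreal (real B * (\<sigma>\<^sup>2 * ln (real m)) / 16)"
  proof (rule ennreal_leI)
    have "\<sigma>\<^sup>2 * (real k * ln (exp 1 * real n / real k)) \<le> \<sigma>\<^sup>2 * (4 * real B * (3 * ln (real m)))"
      using B(4) l3 l4 by (intro mult_left_mono mult_mono) auto
    then show "\<sigma>\<^sup>2 * real k * ln (exp 1 * real n / real k) / 192 \<le> real B * (\<sigma>\<^sup>2 * ln (real m)) / 16"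
      by (simp add: mult_ac)
  qed
  also have "\<dots> \<le> minimax_risk n k \<sigma>"
    by (rule minimax_lower_spikes[OF s _ B(2) m n]) (use k in simp)
  finally show ?thesis .
qed

section \<open>Least squares over jump sets\<close>

definition blk :: "nat \<Rightarrow> nat set \<Rightarrow> nat \<Rightarrow> nat set" where
  "blk n A i = {j. j < n \<and> cell A j = cell A i}"

definition blks :: "nat \<Rightarrow> nat set \<Rightarrow> nat set set" where
  "blks n A = blk n A ` {..<n}"

definition blk_avg :: "nat \<Rightarrow> nat set \<Rightarrow> (nat \<Rightarrow> real) \<Rightarrow> nat \<Rightarrow> real" where
  "blk_avg n A x i = (\<Sum>j\<in>blk n A i. x j) / real (card (blk n A i))"

lemma finite_blks [simp]: "finite (blks n A)"
  by (simp add: blks_def)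

lemma blks_nonempty: "X \<in> blks n A \<Longrightarrow> finite X \<and> X \<noteq> {} \<and> X \<subseteq> {..<n}"
  by (auto simp: blks_def blk_def)

lemma blk_eq: "X \<in> blks n A \<Longrightarrow> i \<in> X \<Longrightarrow> blk n A i = X"
  by (auto simp: blks_def blk_def)

lemma sum_blks: "(\<Sum>i<n. f i) = (\<Sum>X\<in>blks n A. \<Sum>i\<in>X. f i)"
proof -
  have "(\<Sum>X\<in>blks n A. \<Sum>i\<in>{i \<in> {..<n}. blk n A i = X}. f i) = (\<Sum>i<n. f i)"
    by (rule sum.group) (auto simp: blks_def)
  moreover have "{i \<in> {..<n}. blk n A i = X} = X" if "X \<in> blks n A" for X
    using that by (auto simp: blks_def blk_def)
  ultimately show ?thesis by simp
qed

lemma card_blks_le: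
  assumes "finite A" shows "card (blks n A) \<le> card A + 1"
proof -
  have "blks n A \<subseteq> (\<lambda>c. {j. j < n \<and> cell A j = c}) ` {..card A}"
    using cell_le_card[OF assms] by (auto simp: blks_def blk_def)
  then have "card (blks n A) \<le> card ((\<lambda>c. {j. j < n \<and> cell A j = c}) ` {..card A})"
    by (intro card_mono) auto
  also have "\<dots> \<le> card A + 1" using card_image_le[of "{..card A}" "\<lambda>c. {j. j < n \<and> cell A j = c}"] by simp
  finally show ?thesis .
qed

lemma constant_on_blks:
  assumes "finite A" "jumps n v \<subseteq> A" "X \<in> blks n A" "i \<in> X" "j \<in> X"
  shows "v i = v j"
  by (rule constant_on_cell[OF assms(1,2)]) (use assms in \<open>auto simp: blks_def blk_def\<close>)

lemma cell_pred:
  assumes "i \<notin> A" "0 < i" shows "cell A i = cell A (i - 1)"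
proof -
  have "{a \<in> A. a \<le> i} = {a \<in> A. a \<le> i - 1}"
    using assms by (auto simp: le_less)
  then show ?thesis by (simp add: cell_def)
qed

lemma jumps_blk_avg: "jumps n (blk_avg n A x) \<subseteq> A"
proof
  fix i assume i: "i \<in> jumps n (blk_avg n A x)"
  show "i \<in> A"
  proof (rule ccontr)
    assume "i \<notin> A"
    then have "blk n A i = blk n A (i - 1)" using cell_pred i by (auto simp: blk_def jumps_def)
    then show False using i by (simp add: jumps_def blk_avg_def)
  qed
qed

text \<open>A block fills the range between its minimum and maximum because \<open>cell\<close> is
  monotone. It can only stop at a point of \<open>A\<close> or at the boundary, as the neighbouring
  index would otherwise share its count.\<close>

lemma blks_interval:
  assumes A: "finite A" and X: "X \<in> blks n A"
  obtains lo hi where "X = {lo..<hi}" "lo < hi" "hi \<le> n" "lo = 0 \<or> lo \<in> A" "hi = n \<or> hi \<in> A"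
    "\<And>a. a \<in> A \<Longrightarrow> lo < a \<Longrightarrow> a < hi \<Longrightarrow> False"
proof -
  obtain i where i: "i < n" "X = blk n A i" using X by (auto simp: blks_def)
  have fX: "finite X" "X \<noteq> {}" using blks_nonempty[OF X] by auto
  have mem: "j \<in> X \<longleftrightarrow> j < n \<and> cell A j = cell A i" for j by (simp add: i(2) blk_def)
  define lo where "lo = Min X"
  define M where "M = Max X"
  have lo: "lo \<in> X" "\<And>j. j \<in> X \<Longrightarrow> lo \<le> j" using fX by (auto simp: lo_def)
  have M: "M \<in> X" "\<And>j. j \<in> X \<Longrightarrow> j \<le> M" using fX by (auto simp: M_def)
  show ?thesis
  proof (rule that[of lo "Suc M"])
    show "X = {lo..<Suc M}"
    proof (intro set_eqI iffI)
      fix j assume j: "j \<in> {lo..<Suc M}"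
      then have "cell A lo \<le> cell A j" "cell A j \<le> cell A M" using cell_mono[OF A] by auto
      then show "j \<in> X" using lo(1) M(1) j unfolding mem by auto
    qed (use lo M in \<open>auto simp: less_Suc_eq_le\<close>)
    show "lo < Suc M" using lo M by (simp add: less_Suc_eq_le)
    show "Suc M \<le> n" using M(1) mem by auto
    show "lo = 0 \<or> lo \<in> A"
    proof (rule ccontr)
      assume "\<not> (lo = 0 \<or> lo \<in> A)"
      then have "lo - 1 \<in> X" "0 < lo" using cell_pred[of lo A] lo(1) unfolding mem by auto
      then show False using lo(2)[of "lo - 1"] by simp
    qed
    show "Suc M = n \<or> Suc M \<in> A"
    proof (rule ccontr)
      assume "\<not> (Suc M = n \<or> Suc M \<in> A)"
      then have "Suc M \<in> X" using cell_pred[of "Suc M" A] M(1) unfolding mem by auto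
      then show False using M(2)[of "Suc M"] by simp
    qed
    fix a assume a: "a \<in> A" "lo < a" "a < Suc M"
    have "cell A lo = cell A M" using lo(1) M(1) mem by auto
    then show False using cell_eq_imp_no_jump[OF A _ _ a(1), of lo M] a by auto
  qed
qed

lemma sum_sq_mean_le:
  fixes x :: "'a \<Rightarrow> real"
  assumes "finite X" "X \<noteq> {}"
  shows "(\<Sum>i\<in>X. (x i - (\<Sum>j\<in>X. x j) / real (card X))\<^sup>2) \<le> (\<Sum>i\<in>X. (x i - w)\<^sup>2)"
proof -
  define a where "a = (\<Sum>j\<in>X. x j) / real (card X)"
  have N: "0 < real (card X)" using assms by (simp add: card_gt_0_iff)
  have z: "(\<Sum>i\<in>X. x i - a) = 0" using N by (simp add: sum_subtractf a_def)
  have "(\<Sum>i\<in>X. (x i - w)\<^sup>2) = (\<Sum>i\<in>X. (x i - a)\<^sup>2 + 2 * (a - w) * (x i - a) + (a - w)\<^sup>2)"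
    by (intro sum.cong refl) (simp add: power2_eq_square algebra_simps)
  also have "\<dots> = (\<Sum>i\<in>X. (x i - a)\<^sup>2) + 2 * (a - w) * (\<Sum>i\<in>X. x i - a) + real (card X) * (a - w)\<^sup>2"
    by (simp add: sum.distrib sum_distrib_left)
  finally show ?thesis using N by (simp add: z a_def[symmetric])
qed

text \<open>For a fixed partition least squares decouples into blocks, and on each block the mean is
  optimal.\<close>

lemma blk_avg_best:
  assumes A: "finite A" "jumps n v \<subseteq> A"
  shows "(\<Sum>i<n. (x i - blk_avg n A x i)\<^sup>2) \<le> (\<Sum>i<n. (x i - v i)\<^sup>2)"
  unfolding sum_blks[of _ n A]
proof (rule sum_mono)
  fix X assume X: "X \<in> blks n A"
  then have f: "finite X" "X \<noteq> {}" using blks_nonempty by auto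
  then obtain i0 where i0: "i0 \<in> X" by auto
  have "(\<Sum>i\<in>X. (x i - blk_avg n A x i)\<^sup>2) = (\<Sum>i\<in>X. (x i - (\<Sum>j\<in>X. x j) / real (card X))\<^sup>2)"
    using blk_eq[OF X] by (intro sum.cong) (auto simp: blk_avg_def)
  also have "\<dots> \<le> (\<Sum>i\<in>X. (x i - v i0)\<^sup>2)" by (rule sum_sq_mean_le[OF f])
  also have "\<dots> = (\<Sum>i\<in>X. (x i - v i)\<^sup>2)"
    using constant_on_blks[OF A X] i0 by (intro sum.cong refl) metis
  finally show "(\<Sum>i\<in>X. (x i - blk_avg n A x i)\<^sup>2) \<le> (\<Sum>i\<in>X. (x i - v i)\<^sup>2)" .
qed

text \<open>The squared length of the projection of \<open>e\<close> onto the indicator of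
  \<open>X\<close>.\<close>

definition blk_noise :: "(nat \<Rightarrow> real) \<Rightarrow> nat set \<Rightarrow> real" where
  "blk_noise e X = (\<Sum>i\<in>X. e i)\<^sup>2 / real (card X)"

text \<open>Expanding the squares in \<open>ls\<close> bounds the squared norm of
  \<open>u = v - \<theta>\<close> by twice its inner product with the noise. On blocks of a common
  refinement \<open>u\<close> is constant, so that product is at most half the squared norm plus
  \<open>2 * blk_noise\<close>; the half is absorbed on the left.\<close>

lemma least_squares_loss:
  assumes B: "finite B" "jumps n v \<subseteq> B" "jumps n \<theta> \<subseteq> B"
    and ls: "(\<Sum>i<n. (x i - v i)\<^sup>2) \<le> (\<Sum>i<n. (x i - \<theta> i)\<^sup>2)"
  shows "(\<Sum>i<n. (v i - \<theta> i)\<^sup>2) \<le> 4 * (\<Sum>X\<in>blks n B. blk_noise (\<lambda>i. x i - \<theta> i) X)"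
proof -
  define u where "u i = v i - \<theta> i" for i
  define e where "e = (\<lambda>i. x i - \<theta> i)"
  have "(\<Sum>i<n. (x i - v i)\<^sup>2) = (\<Sum>i<n. (x i - \<theta> i)\<^sup>2 - 2 * (e i * u i) + (u i)\<^sup>2)"
    by (intro sum.cong refl) (simp add: u_def e_def power2_eq_square algebra_simps)
  also have "\<dots> = (\<Sum>i<n. (x i - \<theta> i)\<^sup>2) - (\<Sum>i<n. 2 * (e i * u i)) + (\<Sum>i<n. (u i)\<^sup>2)"
    by (simp add: sum.distrib sum_subtractf)
  finally have 1: "(\<Sum>i<n. (u i)\<^sup>2) \<le> (\<Sum>i<n. 2 * (e i * u i))" using ls by simp
  also have "\<dots> = (\<Sum>X\<in>blks n B. \<Sum>i\<in>X. 2 * (e i * u i))" by (rule sum_blks)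
  also have "\<dots> \<le> (\<Sum>X\<in>blks n B. (\<Sum>i\<in>X. (u i)\<^sup>2) / 2 + 2 * blk_noise e X)"
  proof (rule sum_mono)
    fix X assume X: "X \<in> blks n B"
    then have f: "finite X" "X \<noteq> {}" using blks_nonempty by auto
    then obtain i0 where i0: "i0 \<in> X" by auto
    define N where "N = real (card X)"
    define S where "S = (\<Sum>i\<in>X. e i)"
    define c where "c = u i0"
    have N: "0 < N" using f by (simp add: N_def card_gt_0_iff)
    have c: "u i = c" if "i \<in> X" for i
      unfolding u_def c_def using constant_on_blks[OF B(1,2) X that i0] constant_on_blks[OF B(1,3) X that i0] by simp
    have "(\<Sum>i\<in>X. 2 * (e i * u i)) = 2 * c * S" by (simp add: c S_def sum_distrib_right[symmetric] mult_ac flip: sum_distrib_left)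
    moreover have "(\<Sum>i\<in>X. (u i)\<^sup>2) = N * c\<^sup>2" by (simp add: c N_def)
    moreover have "2 * c * S \<le> N * c\<^sup>2 / 2 + 2 * (S\<^sup>2 / N)"
    proof -
      have "0 \<le> (N * c - 2 * S)\<^sup>2 / (2 * N)" using N by simp
      also have "\<dots> = N * c\<^sup>2 / 2 + 2 * (S\<^sup>2 / N) - 2 * c * S"
        using N by (simp add: power2_eq_square field_simps)
      finally show ?thesis by simp
    qed
    ultimately show "(\<Sum>i\<in>X. 2 * (e i * u i)) \<le> (\<Sum>i\<in>X. (u i)\<^sup>2) / 2 + 2 * blk_noise e X"
      by (simp add: blk_noise_def N_def S_def)
  qed
  also have "\<dots> = (\<Sum>i<n. (u i)\<^sup>2) / 2 + 2 * (\<Sum>X\<in>blks n B. blk_noise e X)"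
    by (simp add: sum.distrib sum_distrib_left sum_blks[of "\<lambda>i. (u i)\<^sup>2" n B] sum_divide_distrib)
  finally show ?thesis by (simp add: u_def e_def)
qed

section \<open>A measurable least squares estimator and its risk\<close>

lemma measurable_leb_coordinate: "i < n \<Longrightarrow> (\<lambda>x. x i) \<in> borel_measurable (leb n)"
  using measurable_component_singleton[of i "{..<n}" "\<lambda>_. lborel :: real measure"] by simp

lemma measurable_blk_avg: "(\<lambda>x. blk_avg n A x i) \<in> borel_measurable (leb n)"
  unfolding blk_avg_def
  by (intro borel_measurable_divide borel_measurable_sum borel_measurable_const measurable_leb_coordinate)
     (auto simp: blk_def)

text \<open>Only finitely many jump sets compete. Taking the first one with minimal residual makes
  the selected index a measurable function with countable range, hence the estimator
  measurable.\<close>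

lemma least_squares_estimator:
  obtains est where "est \<in> estimators n"
    "\<And>x. \<exists>A \<subseteq> {1..<n}. card A \<le> d \<and> jumps n (est x) \<subseteq> A"
    "\<And>x v. card (jumps n v) \<le> d \<Longrightarrow> (\<Sum>i<n. (x i - est x i)\<^sup>2) \<le> (\<Sum>i<n. (x i - v i)\<^sup>2)"
proof -
  define \<A> where "\<A> = {A. A \<subseteq> {1..<n} \<and> card A \<le> d}"
  have fin: "finite \<A>" unfolding \<A>_def by (rule finite_subset[of _ "Pow {1..<n}"]) auto
  obtain As where As: "set As = \<A>" using finite_list[OF fin] by blast
  have ne: "0 < length As" using As by (auto simp: \<A>_def intro!: Nat.gr0I)
  define r where "r j x = (\<Sum>i<n. (x i - blk_avg n (As ! j) x i)\<^sup>2)" for j x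
  define ok where "ok j x \<longleftrightarrow> j < length As \<and> (\<forall>j'<length As. r j x \<le> r j' x)" for j x
  define sel where "sel x = (LEAST j. ok j x)" for x
  define est where "est x = blk_avg n (As ! sel x) x" for x
  have ok: "ok (sel x) x" for x
  proof -
    obtain j where "j < length As" "r j x = Min ((\<lambda>j. r j x) ` {..<length As})"
      using Min_in[of "(\<lambda>j. r j x) ` {..<length As}"] ne by fastforce
    then have "ok j x" by (auto simp: ok_def)
    then show ?thesis unfolding sel_def by (rule LeastI)
  qed
  have r: "r j \<in> borel_measurable (leb n)" for j
    unfolding r_def
    by (intro borel_measurable_sum borel_measurable_power borel_measurable_diff measurable_blk_avg measurable_leb_coordinate) auto
  have [measurable]: "Measurable.pred (leb n) (ok j)" for j
  proof -
    have "Measurable.pred (leb n) (\<lambda>x. r j x \<le> r j' x)" for j'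
      unfolding pred_def by (rule borel_measurable_le[OF r r])
    then show ?thesis
      unfolding ok_def[abs_def] by (intro pred_intros_conj1' pred_intros_countable pred_intros_imp')
  qed
  have sel: "sel \<in> measurable (leb n) (count_space UNIV)"
    unfolding sel_def by measurable
  have "est \<in> estimators n"
    unfolding estimators_def est_def
    by (intro CollectI allI impI measurable_compose_countable[OF measurable_blk_avg sel])
  moreover have "\<exists>A \<subseteq> {1..<n}. card A \<le> d \<and> jumps n (est x) \<subseteq> A" for x
  proof -
    have "As ! sel x \<in> \<A>" using ok[of x] As nth_mem unfolding ok_def by blast
    then show ?thesis using jumps_blk_avg unfolding \<A>_def est_def by blast
  qed
  moreover have "(\<Sum>i<n. (x i - est x i)\<^sup>2) \<le> (\<Sum>i<n. (x i - v i)\<^sup>2)" if "card (jumps n v) \<le> d" for x v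
  proof -
    \<comment> \<open>The jump set of \<open>v\<close> is itself a candidate, and averaging over its
      blocks fits at least as well as \<open>v\<close>.\<close>
    have "jumps n v \<in> \<A>" using that by (auto simp: \<A>_def jumps_def)
    then obtain j where j: "j < length As" "As ! j = jumps n v" using As in_set_conv_nth by metis
    have "r (sel x) x \<le> r j x" using ok[of x] j by (auto simp: ok_def)
    also have "\<dots> \<le> (\<Sum>i<n. (x i - v i)\<^sup>2)" unfolding r_def j by (rule blk_avg_best) auto
    finally show ?thesis by (simp add: r_def est_def)
  qed
  ultimately show ?thesis using that by blast
qed

text \<open>Only linearity of the integral enters, so the sets \<open>J q\<close> may overlap and
  the family may be large; its cost is the total weight, since each exponential has mean at most
  2.\<close>

lemma risk_le_expsq:
  fixes w :: "'q \<Rightarrow> real" and J :: "'q \<Rightarrow> nat set"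
  assumes s: "0 < \<sigma>" and Q: "finite Q" "\<And>q. q \<in> Q \<Longrightarrow> J q \<subseteq> {..<n}" "\<And>q. q \<in> Q \<Longrightarrow> 0 \<le> w q" and a: "0 \<le> a"
    and loss: "\<And>x. (\<Sum>i<n. (est x i - \<theta> i)\<^sup>2) \<le> a + (\<Sum>q\<in>Q. w q * expsq \<sigma> (\<lambda>i. x i - \<theta> i) (J q))"
  shows "risk n \<sigma> est \<theta> \<le> ennreal (a + 2 * (\<Sum>q\<in>Q. w q))"
proof -
  interpret prob_space "gauss n \<sigma> \<theta>" by (rule prob_space_gauss[OF s])
  have meas: "(\<lambda>x. expsq \<sigma> (\<lambda>i. x i - \<theta> i) (J q)) \<in> borel_measurable (gauss n \<sigma> \<theta>)" if "q \<in> Q" for q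
  proof -
    have "(\<lambda>x. \<Sum>i\<in>J q. x i - \<theta> i) \<in> borel_measurable (gauss n \<sigma> \<theta>)"
      using Q(2)[OF that] by (intro borel_measurable_sum borel_measurable_diff measurable_gauss_coordinate) auto
    then show ?thesis unfolding expsq_def by measurable
  qed
  have nn: "0 \<le> w q * expsq \<sigma> e (J q)" if "q \<in> Q" for q e
    using Q(3)[OF that] by (simp add: expsq_def)
  have "risk n \<sigma> est \<theta> \<le> (\<integral>\<^sup>+x. ennreal a + (\<Sum>q\<in>Q. ennreal (w q) * ennreal (expsq \<sigma> (\<lambda>i. x i - \<theta> i) (J q))) \<partial>gauss n \<sigma> \<theta>)"
    unfolding risk_def
  proof (rule nn_integral_mono)
    fix x
    have "ennreal (\<Sum>i<n. (est x i - \<theta> i)\<^sup>2) \<le> ennreal (a + (\<Sum>q\<in>Q. w q * expsq \<sigma> (\<lambda>i. x i - \<theta> i) (J q)))"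
      by (rule ennreal_leI[OF loss])
    also have "\<dots> = ennreal a + (\<Sum>q\<in>Q. ennreal (w q * expsq \<sigma> (\<lambda>i. x i - \<theta> i) (J q)))"
      using a nn by (simp add: ennreal_plus sum_nonneg)
    also have "(\<Sum>q\<in>Q. ennreal (w q * expsq \<sigma> (\<lambda>i. x i - \<theta> i) (J q)))
       = (\<Sum>q\<in>Q. ennreal (w q) * ennreal (expsq \<sigma> (\<lambda>i. x i - \<theta> i) (J q)))"
      using Q(3) by (intro sum.cong refl ennreal_mult) (auto simp: expsq_def)
    finally show "ennreal (\<Sum>i<n. (est x i - \<theta> i)\<^sup>2) \<le> ennreal a + (\<Sum>q\<in>Q. ennreal (w q) * ennreal (expsq \<sigma> (\<lambda>i. x i - \<theta> i) (J q)))" .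
  qed
  also have "\<dots> = ennreal a + (\<Sum>q\<in>Q. ennreal (w q) * (\<integral>\<^sup>+x. ennreal (expsq \<sigma> (\<lambda>i. x i - \<theta> i) (J q)) \<partial>gauss n \<sigma> \<theta>))"
    using meas by (simp add: nn_integral_add nn_integral_sum nn_integral_cmult emeasure_space_1 cong: sum.cong)
  also have "\<dots> \<le> ennreal a + (\<Sum>q\<in>Q. ennreal (w q) * 2)"
    using Q(2) by (intro add_left_mono sum_mono mult_left_mono nn_integral_expsq_le[OF s]) auto
  also have "(\<Sum>q\<in>Q. ennreal (w q) * 2) = ennreal (\<Sum>q\<in>Q. w q * 2)"
    using Q(3) by (simp add: sum_ennreal[symmetric] ennreal_mult cong: sum.cong del: sum_ennreal)
  also have "ennreal a + \<dots> = ennreal (a + 2 * (\<Sum>q\<in>Q. w q))"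
    using a Q(3) by (simp add: ennreal_plus[symmetric] sum_nonneg flip: sum_distrib_right del: ennreal_plus)
  finally show ?thesis .
qed

text \<open>This is \<open>y \<le> exp y\<close> at \<open>y = U - ln R\<close>. The free parameter
  \<open>R\<close> trades a deterministic logarithm against the weight \<open>1 / R\<close> of the
  exponential, and is later matched to the number of competing blocks.\<close>

lemma blk_noise_le:
  assumes s: "0 < \<sigma>" and R: "0 < R"
  shows "blk_noise e X \<le> 4 * \<sigma>\<^sup>2 * (ln R + expsq \<sigma> e X / R)"
proof -
  define U where "U = (\<Sum>i\<in>X. e i)\<^sup>2 / (4 * \<sigma>\<^sup>2 * real (card X))"
  have "U - ln R \<le> exp (U - ln R)" using exp_ge_add_one_self[of "U - ln R"] by linarith
  also have "\<dots> = expsq \<sigma> e X / R" using R by (simp add: exp_diff expsq_def U_def)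
  finally have "4 * \<sigma>\<^sup>2 * U \<le> 4 * \<sigma>\<^sup>2 * (ln R + expsq \<sigma> e X / R)" by (intro mult_left_mono) auto
  moreover have "4 * \<sigma>\<^sup>2 * U = blk_noise e X" using s by (simp add: U_def blk_noise_def)
  ultimately show ?thesis by simp
qed

lemma blk_noise_nonneg: "0 \<le> blk_noise e X"
  by (simp add: blk_noise_def)

section \<open>Upper bounds for one and for many pieces\<close>

text \<open>There is only one block, so \<open>R = 1\<close> suffices: the factors are 4 from the
  loss, 4 from the noise bound and 2 from the exponential moment.\<close>

lemma minimax_upper_one_piece:
  assumes s: "0 < \<sigma>" shows "minimax_risk n 1 \<sigma> \<le> ennreal (32 * \<sigma>\<^sup>2)"
proof -
  obtain est where est: "est \<in> estimators n"
    "\<And>x. \<exists>A \<subseteq> {1..<n}. card A \<le> 0 \<and> jumps n (est x) \<subseteq> A"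
    "\<And>x v. card (jumps n v) \<le> 0 \<Longrightarrow> (\<Sum>i<n. (x i - est x i)\<^sup>2) \<le> (\<Sum>i<n. (x i - v i)\<^sup>2)"
    using least_squares_estimator[of n 0] by blast
  show ?thesis
  proof (rule minimax_risk_leI[OF est(1)])
    fix \<theta> assume "\<theta> \<in> Theta n 1"
    then have c: "card (jumps n \<theta>) \<le> 0" using ThetaD[of \<theta> n 1] by simp
    have "risk n \<sigma> est \<theta> \<le> ennreal (0 + 2 * (\<Sum>q\<in>{()}. 16 * \<sigma>\<^sup>2))"
    proof (rule risk_le_expsq[OF s, where J = "\<lambda>_. {..<n}"])
      fix x
      define e where "e = (\<lambda>i. x i - \<theta> i)"
      obtain A where A: "A \<subseteq> {1..<n}" "card A \<le> 0" "jumps n (est x) \<subseteq> A" using est(2) by blast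
      then have "jumps n (est x) \<subseteq> {}" using finite_subset[OF A(1)] by simp
      then have "(\<Sum>i<n. (est x i - \<theta> i)\<^sup>2) \<le> 4 * (\<Sum>X\<in>blks n {}. blk_noise e X)"
        unfolding e_def using c est(3)[OF c] by (intro least_squares_loss) auto
      also have "\<dots> \<le> 4 * (\<Sum>X\<in>{{..<n}}. blk_noise e X)"
        by (intro mult_left_mono sum_mono2) (auto simp: blks_def blk_def cell_def blk_noise_nonneg)
      also have "\<dots> \<le> 4 * (4 * \<sigma>\<^sup>2 * expsq \<sigma> e {..<n})"
        using blk_noise_le[OF s, of 1 e "{..<n}"] by (simp add: mult_ac)
      finally show "(\<Sum>i<n. (est x i - \<theta> i)\<^sup>2) \<le> 0 + (\<Sum>q\<in>{()}. 16 * \<sigma>\<^sup>2 * expsq \<sigma> (\<lambda>i. x i - \<theta> i) {..<n})"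
        by (simp add: e_def)
    qed auto
    then show "risk n \<sigma> est \<theta> \<le> ennreal (32 * \<sigma>\<^sup>2)" by simp
  qed
qed

lemma minimax_upper_many_pieces:
  assumes s: "0 < \<sigma>" and k: "1 \<le> k" "k \<le> n"
  shows "minimax_risk n k \<sigma> \<le> ennreal (128 * (\<sigma>\<^sup>2 * real k * ln (exp 1 * real n / real k)))"
proof -
  obtain est where est: "est \<in> estimators n"
    "\<And>x. \<exists>A \<subseteq> {1..<n}. card A \<le> k - 1 \<and> jumps n (est x) \<subseteq> A"
    "\<And>x v. card (jumps n v) \<le> k - 1 \<Longrightarrow> (\<Sum>i<n. (x i - est x i)\<^sup>2) \<le> (\<Sum>i<n. (x i - v i)\<^sup>2)"
    using least_squares_estimator[of n "k - 1"] by blast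
  define \<Lambda> where "\<Lambda> = ln (exp 1 * real n / real k)"
  \<comment> \<open>The square makes \<open>k * R\<close> dominate \<open>card Q\<close>, which is
    of order n^2/k, while \<open>ln R\<close> is still only twice the target logarithm.\<close>
  define R where "R = (exp 1 * real n / real k)\<^sup>2"
  define h where "h = n div k + 1"
  define D where "D = {i \<in> {1..<n}. h dvd i}"
  define Q where "Q = {..<n} \<times> {..h}"
  define J where "J = (\<lambda>(a, l). {a..<a + l} \<inter> {..<n})"
  have R: "0 < R" using k by (simp add: R_def)
  have lnR: "ln R = 2 * \<Lambda>" unfolding R_def \<Lambda>_def using k by (subst ln_realpow) auto
  have L1: "1 \<le> \<Lambda>"
  proof -
    have "\<Lambda> = 1 + ln (real n / real k)"
      unfolding \<Lambda>_def times_divide_eq_right[symmetric] using k by (subst ln_mult_pos) auto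
    moreover have "0 \<le> ln (real n / real k)" using k by (intro ln_ge_zero) auto
    ultimately show ?thesis by simp
  qed
  have cD: "card D \<le> k - 1"
  proof -
    \<comment> \<open>The mesh exceeds \<open>n / k\<close>, so fewer than \<open>k\<close> of its
      multiples fit below \<open>n\<close> and the grid costs no more points than the jumps
      do.\<close>
    have "n < k * h" using k dividend_less_times_div[of k n] by (simp add: h_def)
    then have nh: "n div h < k" by (simp add: less_mult_imp_div_less)
    have "D \<subseteq> (\<lambda>j. h * j) ` {1..n div h}"
    proof
      fix i assume "i \<in> D"
      then obtain j where j: "i = h * j" "1 \<le> i" "i < n" by (auto simp: D_def)
      have "0 < h" by (simp add: h_def)
      then have "j = i div h" using j(1) by simp
      also have "\<dots> \<le> n div h" using j by (intro div_le_mono) simp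
      finally show "i \<in> (\<lambda>j. h * j) ` {1..n div h}" using j by (intro image_eqI[of _ _ j]) (auto intro: Suc_leI Nat.gr0I)
    qed
    then have "card D \<le> card ((\<lambda>j. h * j) ` {1..n div h})" by (intro card_mono) auto
    also have "\<dots> \<le> n div h" using card_image_le[of "{1..n div h}" "\<lambda>j. h * j"] by simp
    finally show ?thesis using nh by simp
  qed
  show ?thesis
  proof (rule minimax_risk_leI[OF est(1)])
    fix \<theta> assume "\<theta> \<in> Theta n k"
    then have c: "card (jumps n \<theta>) \<le> k - 1" by (rule ThetaD)
    have "risk n \<sigma> est \<theta> \<le> ennreal (96 * \<sigma>\<^sup>2 * real k * \<Lambda> + 2 * (\<Sum>q\<in>Q. 16 * \<sigma>\<^sup>2 / R))"
    proof (rule risk_le_expsq[OF s, where J = J])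
      fix x
      define e where "e = (\<lambda>i. x i - \<theta> i)"
      obtain A where A: "A \<subseteq> {1..<n}" "card A \<le> k - 1" "jumps n (est x) \<subseteq> A" using est(2) by blast
      define B where "B = A \<union> jumps n \<theta> \<union> D"
      have fB: "finite B" using finite_subset[OF A(1)] by (simp add: B_def D_def)
      have "card B \<le> card A + card (jumps n \<theta>) + card D"
        unfolding B_def by (meson add_le_mono1 card_Un_le le_trans)
      \<comment> \<open>Three sets of at most \<open>k - 1\<close> points cut out at most
        \<open>3 * (k - 1) + 1\<close> blocks.\<close>
      then have cB: "card (blks n B) \<le> 3 * k" using card_blks_le[OF fB, of n] A(2) c cD k by linarith
      have sub: "blks n B \<subseteq> J ` Q"
      proof
        fix X assume "X \<in> blks n B"
        then obtain lo hi where X: "X = {lo..<hi}" "lo < hi" "hi \<le> n" "\<And>a. a \<in> B \<Longrightarrow> lo < a \<Longrightarrow> a < hi \<Longrightarrow> False"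
          using blks_interval[OF fB] by metis
        \<comment> \<open>In a longer block the first multiple of \<open>h\<close> beyond
          \<open>lo\<close> would be an interior grid point.\<close>
        have "hi - lo \<le> h"
        proof (rule ccontr)
          assume "\<not> hi - lo \<le> h"
          then have hl: "lo + h < hi" by simp
          define a where "a = h * (lo div h + 1)"
          have "lo < a" using dividend_less_times_div[of h lo] by (simp add: a_def h_def)
          moreover have "a \<le> lo + h" by (simp add: a_def distrib_left)
          ultimately have "1 \<le> a" "a < n" using hl X(3) by linarith+
          then have "a \<in> D" by (simp add: D_def) (simp add: a_def)
          then show False using X(4)[of a] \<open>lo < a\<close> \<open>a \<le> lo + h\<close> hl by (auto simp: B_def)
        qed
        then show "X \<in> J ` Q" using X by (intro image_eqI[of _ _ "(lo, hi - lo)"]) (auto simp: J_def Q_def)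
      qed
      have "(\<Sum>i<n. (est x i - \<theta> i)\<^sup>2) \<le> 4 * (\<Sum>X\<in>blks n B. blk_noise e X)"
        unfolding e_def using est(3)[OF c] A fB by (intro least_squares_loss) (auto simp: B_def)
      also have "\<dots> \<le> 4 * (\<Sum>X\<in>blks n B. 4 * \<sigma>\<^sup>2 * (2 * \<Lambda> + expsq \<sigma> e X / R))"
        using blk_noise_le[OF s R, of e] by (intro mult_left_mono sum_mono) (simp_all add: lnR)
      also have "\<dots> = 32 * \<sigma>\<^sup>2 * \<Lambda> * real (card (blks n B)) + 16 * \<sigma>\<^sup>2 / R * (\<Sum>X\<in>blks n B. expsq \<sigma> e X)"
        by (simp add: sum.distrib sum_distrib_left[symmetric] distrib_left sum_divide_distrib[symmetric])
      also have "\<dots> \<le> 32 * \<sigma>\<^sup>2 * \<Lambda> * (3 * real k) + 16 * \<sigma>\<^sup>2 / R * (\<Sum>q\<in>Q. expsq \<sigma> e (J q))"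
      proof (intro add_mono mult_left_mono)
        have "real (card (blks n B)) \<le> real (3 * k)" using cB by (simp only: of_nat_le_iff)
        then show "real (card (blks n B)) \<le> 3 * real k" by simp
        have "(\<Sum>X\<in>blks n B. expsq \<sigma> e X) \<le> (\<Sum>X\<in>J ` Q. expsq \<sigma> e X)"
          using sub by (intro sum_mono2) (auto simp: Q_def expsq_def)
        also have "\<dots> \<le> (\<Sum>q\<in>Q. (expsq \<sigma> e \<circ> J) q)"
          by (rule sum_image_le) (auto simp: Q_def expsq_def)
        finally show "(\<Sum>X\<in>blks n B. expsq \<sigma> e X) \<le> (\<Sum>q\<in>Q. expsq \<sigma> e (J q))" by simp
      qed (use L1 R in auto)
      finally show "(\<Sum>i<n. (est x i - \<theta> i)\<^sup>2) \<le> 96 * \<sigma>\<^sup>2 * real k * \<Lambda>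
          + (\<Sum>q\<in>Q. 16 * \<sigma>\<^sup>2 / R * expsq \<sigma> (\<lambda>i. x i - \<theta> i) (J q))"
        by (simp add: e_def sum_distrib_left sum_divide_distrib mult_ac)
    qed (use R L1 in \<open>auto simp: Q_def J_def\<close>)
    also have "\<dots> \<le> ennreal (128 * (\<sigma>\<^sup>2 * real k * \<Lambda>))"
    proof (rule ennreal_leI)
      \<comment> \<open>From here on \<open>card Q / R \<le> k\<close> is derived, so the
        exponentials add at most 32 to the 96 coming from the logarithms.\<close>
      have h3: "real h + 1 \<le> 3 * (real n / real k)"
      proof -
        have "real (n div k) \<le> real n / real k" by (rule of_nat_div_le_of_nat)
        moreover have "1 \<le> real n / real k" using k by simp
        ultimately show ?thesis by (simp add: h_def)
      qed
      have "(4::real) \<le> exp 1 * exp 1"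
        using mult_mono[of 2 "exp 1" 2 "exp (1::real)"] exp_ge_add_one_self[of "1::real"] by simp
      then have R4: "4 * (real n / real k)\<^sup>2 \<le> R"
        unfolding R_def times_divide_eq_right[symmetric] power_mult_distrib
        by (intro mult_right_mono) (auto simp: power2_eq_square)
      have "real (card Q) = real n * (real h + 1)" by (simp add: Q_def distrib_left)
      also have "\<dots> \<le> real n * (3 * (real n / real k))" by (intro mult_left_mono h3) auto
      also have "\<dots> = 3 * real k * (real n / real k)\<^sup>2" using k by (simp add: power2_eq_square)
      also have "\<dots> \<le> real k * (4 * (real n / real k)\<^sup>2)" by (simp add: mult_right_mono)
      also have "\<dots> \<le> real k * R" by (intro mult_left_mono R4) auto
      finally have cQ: "real (card Q) / R \<le> real k" using R by (simp add: divide_le_eq)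
      have "2 * (\<Sum>q\<in>Q. 16 * \<sigma>\<^sup>2 / R) = 32 * \<sigma>\<^sup>2 * (real (card Q) / R)" by simp
      also have "\<dots> \<le> 32 * \<sigma>\<^sup>2 * (real k * \<Lambda>)"
      proof (rule mult_left_mono)
        have "real k * 1 \<le> real k * \<Lambda>" by (intro mult_left_mono L1) auto
        then show "real (card Q) / R \<le> real k * \<Lambda>" using cQ by simp
      qed auto
      finally show "96 * \<sigma>\<^sup>2 * real k * \<Lambda> + 2 * (\<Sum>q\<in>Q. 16 * \<sigma>\<^sup>2 / R) \<le> 128 * (\<sigma>\<^sup>2 * real k * \<Lambda>)"
        by (simp add: mult_ac)
    qed
    finally show "risk n \<sigma> est \<theta> \<le> ennreal (128 * (\<sigma>\<^sup>2 * real k * ln (exp 1 * real n / real k)))"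
      by (simp add: \<Lambda>_def)
  qed
qed

section \<open>Dyadic chaining and the upper bound for two pieces\<close>

lemma sqrt2_power_squared: "(sqrt 2 ^ l)\<^sup>2 = (2::real) ^ l"
  by (metis power_mult mult.commute real_sqrt_pow2 zero_le_numeral)

text \<open>Dropping the last binary digit of \<open>q\<close> gives the recursion \<open>t\<^sub>i\<^sub>+\<^sub>1 = sqrt 2 t\<^sub>i + (i + 3)\<close>
  for the bound; the subtracted linear term in the closed form absorbs the increments.\<close>

lemma dyadic_chaining_step:
  fixes y :: "nat \<Rightarrow> real"
  assumes s: "0 < \<sigma>" and A: "1 \<le> A"
    and D: "\<And>l p. (p + 1) * 2 ^ l \<le> M \<Longrightarrow>
      (\<Sum>i\<in>{p * 2 ^ l..<(p + 1) * 2 ^ l}. y i)\<^sup>2 \<le> 4 * \<sigma>\<^sup>2 * 2 ^ l * (A + 2 * ln (real p + 1))"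
    and q: "2 ^ i \<le> q" "q < 2 ^ (i + 1)" "q * 2 ^ l \<le> M"
  shows "\<bar>\<Sum>j<q * 2 ^ l. y j\<bar> \<le> 2 * \<sigma> * sqrt A * sqrt 2 ^ l * (16 * sqrt 2 ^ i - (5 / 2 * real i + 14))"
  using q
proof (induction i arbitrary: q l)
  case (0 q l)
  then have q1: "q = 1" by simp
  have "(\<Sum>j<2 ^ l. y j)\<^sup>2 \<le> 4 * \<sigma>\<^sup>2 * 2 ^ l * (A + 0)"
    using D[of 0 l] 0 q1 by (simp add: lessThan_atLeast0)
  \<comment> \<open>The closed form at \<open>i = 0\<close> is 16 - 14 = 2, which explains the last
    factor.\<close>
  also have "\<dots> \<le> (2 * \<sigma> * sqrt A * sqrt 2 ^ l * 2)\<^sup>2"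
    using A by (simp add: power_mult_distrib sqrt2_power_squared)
  finally have "\<bar>\<Sum>j<2 ^ l. y j\<bar> \<le> \<bar>2 * \<sigma> * sqrt A * sqrt 2 ^ l * 2\<bar>"
    by (simp only: abs_le_square_iff)
  then have "\<bar>\<Sum>j<2 ^ l. y j\<bar> \<le> 2 * \<sigma> * sqrt A * sqrt 2 ^ l * 2"
    using s A by simp
  then show ?case using q1 by simp
next
  case (Suc i q l)
  define c where "c = 2 * \<sigma> * sqrt A * sqrt 2 ^ l"
  have c: "0 \<le> c" using s A by (simp add: c_def)
  define q' where "q' = q div 2"
  have q': "2 ^ i \<le> q'" "q' < 2 ^ (i + 1)" using Suc.prems by (auto simp: q'_def)
  have "q' * 2 \<le> q" by (simp add: q'_def)
  then have le: "q' * 2 ^ (l + 1) \<le> q * 2 ^ l" by simp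
  have IH: "\<bar>\<Sum>j<q' * 2 ^ (l + 1). y j\<bar> \<le> c * (sqrt 2 * (16 * sqrt 2 ^ i - (5 / 2 * real i + 14)))"
    using Suc.IH[OF q' order_trans[OF le Suc.prems(3)]] by (simp add: c_def mult_ac)
  \<comment> \<open>If the dropped digit is 0 nothing changes; if it is 1, the difference is the
    single dyadic block number \<open>q - 1\<close> of level \<open>l\<close>, to which
    \<open>D\<close> applies.\<close>
  have inc: "\<bar>(\<Sum>j<q * 2 ^ l. y j) - (\<Sum>j<q' * 2 ^ (l + 1). y j)\<bar> \<le> c * (real i + 3)"
  proof (cases "even q")
    case True
    then have eq: "q * 2 ^ l = q' * 2 ^ (l + 1)" by (simp add: q'_def)
    show ?thesis using c unfolding eq by simp
  next
    case False
    then have q'q: "q' * 2 = q - 1" "1 \<le> q" by (auto simp: q'_def elim!: oddE)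
    then have eq: "q' * 2 ^ (l + 1) = (q - 1) * 2 ^ l" by (metis mult.assoc power_add power_one_right mult.commute)
    define d where "d = (\<Sum>j\<in>{(q - 1) * 2 ^ l..<q * 2 ^ l}. y j)"
    have diff: "(\<Sum>j<q * 2 ^ l. y j) - (\<Sum>j<q' * 2 ^ (l + 1). y j) = d"
      unfolding eq d_def lessThan_atLeast0 by (rule sum_diff_nat_ivl) auto
    have "ln (real q) \<le> ln (2 ^ (i + 2))"
    proof (subst ln_le_cancel_iff)
      have "q \<le> 2 ^ (i + 2)" using Suc.prems(2) by simp
      then have "real q \<le> real (2 ^ (i + 2))" by (simp only: of_nat_le_iff)
      then show "real q \<le> 2 ^ (i + 2)" by simp
    qed (use q'q in auto)
    also have "\<dots> = real (i + 2) * ln 2" by (rule ln_realpow)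
    also have "\<dots> \<le> real (i + 2) * 1" using ln_2_less_1 by (intro mult_left_mono) auto
    finally have lq: "ln (real q) \<le> real i + 2" by simp
    have "A + 2 * ln (real q) \<le> A + 2 * (real i + 2)" using lq by simp
    also have "\<dots> \<le> A + A * (2 * (real i + 2))" using A mult_right_mono[of 1 A "2 * (real i + 2)"] by simp
    also have "\<dots> \<le> A * (real i + 3)\<^sup>2"
    proof -
      have "A * (1 + 2 * (real i + 2)) \<le> A * (real i + 3)\<^sup>2"
        using A by (intro mult_left_mono) (auto simp: power2_eq_square algebra_simps)
      then show ?thesis by (simp add: distrib_left)
    qed
    finally have Aq: "A + 2 * ln (real q) \<le> A * (real i + 3)\<^sup>2" .
    have "d\<^sup>2 \<le> 4 * \<sigma>\<^sup>2 * 2 ^ l * (A + 2 * ln (real q))"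
      using D[of "q - 1" l] Suc.prems(3) q'q by (simp add: d_def of_nat_diff)
    also have "\<dots> \<le> 4 * \<sigma>\<^sup>2 * 2 ^ l * (A * (real i + 3)\<^sup>2)" by (intro mult_left_mono Aq) auto
    also have "\<dots> = (c * (real i + 3))\<^sup>2"
      using A by (simp add: c_def power_mult_distrib sqrt2_power_squared)
    finally have "d\<^sup>2 \<le> (c * (real i + 3))\<^sup>2" .
    then have "\<bar>d\<bar> \<le> \<bar>c * (real i + 3)\<bar>" by (simp only: abs_le_square_iff)
    then show ?thesis using c unfolding diff by simp
  qed
  have "\<bar>\<Sum>j<q * 2 ^ l. y j\<bar> \<le> c * (sqrt 2 * (16 * sqrt 2 ^ i - (5 / 2 * real i + 14))) + c * (real i + 3)"
    using IH inc by linarith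
  also have "\<dots> = c * (16 * sqrt 2 ^ Suc i - (sqrt 2 * (5 / 2 * real i + 14) - (real i + 3)))"
    by (simp add: algebra_simps)
  also have "\<dots> \<le> c * (16 * sqrt 2 ^ Suc i - (5 / 2 * real (Suc i) + 14))"
  proof (intro mult_left_mono c diff_left_mono)
    \<comment> \<open>With 7/5 in place of \<open>sqrt 2\<close> the slope 5/2 reproduces itself,
      since 7/5 * 5/2 - 1 = 5/2, and the intercept 14 satisfies 7/5 * 14 - 3 >= 5/2 + 14.\<close>
    have "(7 / 5 :: real) \<le> sqrt 2" by (rule real_le_rsqrt) (simp add: power2_eq_square)
    then have slope: "7 / 5 * (5 / 2 * real i + 14) \<le> sqrt 2 * (5 / 2 * real i + 14)" by (intro mult_right_mono) auto
    have "5 / 2 * real (Suc i) + 14 \<le> 7 / 5 * (5 / 2 * real i + 14) - (real i + 3)"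
      by (simp add: field_simps)
    then show "5 / 2 * real (Suc i) + 14 \<le> sqrt 2 * (5 / 2 * real i + 14) - (real i + 3)"
      by (rule order_trans) (rule diff_right_mono[OF slope])
  qed
  finally show ?case by (simp add: c_def)
qed

text \<open>The case \<open>l = 0\<close>, \<open>q = m\<close> of the step;
  \<open>2 ^ i \<le> m\<close> then turns the geometric factor into \<open>sqrt m\<close>, and 1024
  = (2 * 16)^2.\<close>

lemma dyadic_chaining:
  fixes y :: "nat \<Rightarrow> real"
  assumes s: "0 < \<sigma>" and A: "1 \<le> A"
    and D: "\<And>l p. (p + 1) * 2 ^ l \<le> M \<Longrightarrow>
      (\<Sum>i\<in>{p * 2 ^ l..<(p + 1) * 2 ^ l}. y i)\<^sup>2 \<le> 4 * \<sigma>\<^sup>2 * 2 ^ l * (A + 2 * ln (real p + 1))"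
    and m: "1 \<le> m" "m \<le> M"
  shows "(\<Sum>j<m. y j)\<^sup>2 \<le> 1024 * \<sigma>\<^sup>2 * A * real m"
proof -
  have "\<exists>i. 2 ^ i \<le> m \<and> m < 2 ^ (i + 1)" by (rule ex_power_ivl1) (use m in auto)
  then obtain i where i: "2 ^ i \<le> m" "m < 2 ^ (i + 1)" by blast
  have "real (2 ^ i) \<le> real m" using i(1) by (simp only: of_nat_le_iff)
  then have im: "2 ^ i \<le> real m" by simp
  have "\<bar>\<Sum>j<m * 2 ^ 0. y j\<bar> \<le> 2 * \<sigma> * sqrt A * sqrt 2 ^ 0 * (16 * sqrt 2 ^ i - (5 / 2 * real i + 14))"
    by (rule dyadic_chaining_step[OF s A D i]) (use m in auto)
  also have "\<dots> \<le> 2 * \<sigma> * sqrt A * sqrt 2 ^ 0 * (16 * sqrt 2 ^ i)"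
    using s A by (intro mult_left_mono) auto
  finally have "\<bar>\<Sum>j<m. y j\<bar> \<le> 32 * \<sigma> * sqrt A * sqrt 2 ^ i" by simp
  then have "\<bar>\<Sum>j<m. y j\<bar>\<^sup>2 \<le> (32 * \<sigma> * sqrt A * sqrt 2 ^ i)\<^sup>2" by (intro power_mono) auto
  also have "\<dots> = 1024 * \<sigma>\<^sup>2 * A * 2 ^ i"
    using A by (simp add: power_mult_distrib sqrt2_power_squared)
  also have "\<dots> \<le> 1024 * \<sigma>\<^sup>2 * A * real m" using A im by (intro mult_left_mono) auto
  finally show ?thesis by simp
qed

section \<open>Noise maxima along enumerations of the indices\<close>

definition dyads :: "nat \<Rightarrow> nat \<Rightarrow> (nat \<times> nat) set" where
  "dyads L M = {(l, p). l < L \<and> p < M \<and> (p + 1) * 2 ^ l \<le> M}"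

lemma finite_dyads [simp]: "finite (dyads L M)"
  unfolding dyads_def by (rule finite_subset[of _ "{..<L} \<times> {..<M}"]) auto

text \<open>From the second term on, each term is at most a difference of consecutive reciprocals,
  so the sum telescopes.\<close>

lemma sum_inverse_squares_le: "(\<Sum>p<M. 1 / (real p + 1)\<^sup>2) \<le> 2"
proof -
  have "(\<Sum>p<Suc M. 1 / (real p + 1)\<^sup>2) \<le> 2 - 1 / (real M + 1)" for M
  proof (induction M)
    case (Suc M)
    have "1 / (real (Suc M) + 1)\<^sup>2 \<le> 1 / ((real M + 1) * (real (Suc M) + 1))"
      unfolding power2_eq_square by (intro divide_left_mono mult_right_mono) auto
    also have "\<dots> = 1 / (real M + 1) - 1 / (real (Suc M) + 1)"
      by (simp add: field_simps)
    finally have "1 / (real (Suc M) + 1)\<^sup>2 \<le> 1 / (real M + 1) - 1 / (real (Suc M) + 1)" .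
    then show ?case using Suc.IH by simp
  qed simp
  then have *: "(\<Sum>p<Suc M. 1 / (real p + 1)\<^sup>2) \<le> 2 - 1 / (real M + 1)" .
  have "(\<Sum>p<M. 1 / (real p + 1)\<^sup>2) \<le> (\<Sum>p<Suc M. 1 / (real p + 1)\<^sup>2)" by simp
  also have "\<dots> \<le> 2" using * by (rule order_trans) simp
  finally show ?thesis .
qed

lemma sum_dyads_le:
  assumes "1 \<le> L"
  shows "(\<Sum>(l, p)\<in>dyads L M. 1 / (real L * (real p + 1)\<^sup>2)) \<le> 2"
proof -
  have "(\<Sum>(l, p)\<in>dyads L M. 1 / (real L * (real p + 1)\<^sup>2)) \<le> (\<Sum>(l, p)\<in>{..<L} \<times> {..<M}. 1 / (real L * (real p + 1)\<^sup>2))"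
    by (rule sum_mono2) (auto simp: dyads_def)
  also have "\<dots> = (\<Sum>l<L. \<Sum>p<M. 1 / (real L * (real p + 1)\<^sup>2))"
    by (rule sum.cartesian_product[symmetric])
  also have "\<dots> = (\<Sum>p<M. 1 / (real p + 1)\<^sup>2)"
    using assms by (simp add: sum_distrib_left)
  finally show ?thesis using sum_inverse_squares_le[of M] by simp
qed

text \<open>Dyadic block \<open>(l, p)\<close> gets \<open>R = L * (p + 1)\<^sup>2\<close>. The
  logarithm of \<open>R\<close> has exactly the growth in \<open>p\<close> that chaining tolerates,
  and the weights \<open>1 / R\<close> have bounded sum over all levels and positions. As
  \<open>L\<close> is about log n, \<open>ln L\<close> is the iterated logarithm. The enumeration
  \<open>\<pi>\<close> allows forward and backward partial sums alike.\<close>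

lemma blk_noise_prefix_le:
  fixes e :: "nat \<Rightarrow> real" and \<pi> :: "nat \<Rightarrow> nat"
  assumes s: "0 < \<sigma>" and inj: "inj_on \<pi> {..<M}" and L: "1 \<le> L" "M < 2 ^ L" and m: "1 \<le> m" "m \<le> M"
  defines "W \<equiv> (\<Sum>(l, p)\<in>dyads L M. 1 / (real L * (real p + 1)\<^sup>2) * expsq \<sigma> e (\<pi> ` {p * 2 ^ l..<(p + 1) * 2 ^ l}))"
  shows "blk_noise e (\<pi> ` {..<m}) \<le> 1024 * \<sigma>\<^sup>2 * (1 + ln (real L) + W)"
proof -
  define A where "A = 1 + ln (real L) + W"
  have W: "0 \<le> W" unfolding W_def by (intro sum_nonneg) (auto simp: expsq_def)
  have A: "1 \<le> A" using W L by (simp add: A_def)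
  have "(\<Sum>j<m. e (\<pi> j))\<^sup>2 \<le> 1024 * \<sigma>\<^sup>2 * A * real m"
  proof (rule dyadic_chaining[OF s A _ m])
    fix l p assume lp: "(p + 1) * 2 ^ l \<le> M"
    let ?I = "{p * 2 ^ l..<(p + 1) * 2 ^ l}"
    define R where "R = real L * (real p + 1)\<^sup>2"
    have R: "0 < R" using L by (simp add: R_def)
    have lnR: "ln R = ln (real L) + 2 * ln (real p + 1)"
      unfolding R_def using L by (subst ln_mult_pos) (auto simp: ln_realpow)
    have "2 ^ l \<le> (p + 1) * (2::nat) ^ l" by simp
    then have "(2::nat) ^ l < 2 ^ L" using lp L(2) by linarith
    then have "l < L" by simp
    moreover have "p < M"
    proof -
      have "(p + 1) * 1 \<le> (p + 1) * (2::nat) ^ l" by (intro mult_le_mono2) simp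
      then have "p + 1 \<le> M" using lp by (simp only: mult_1_right)
      then show ?thesis by simp
    qed
    ultimately have mem: "(l, p) \<in> dyads L M" using lp by (simp add: dyads_def)
    have inj': "inj_on \<pi> ?I" by (rule inj_on_subset[OF inj]) (use lp in auto)
    have card: "card (\<pi> ` ?I) = 2 ^ l" using card_image[OF inj'] by simp
    have "(\<Sum>i\<in>?I. e (\<pi> i)) = (\<Sum>i\<in>\<pi> ` ?I. e i)" using inj' by (simp add: sum.reindex)
    then have "(\<Sum>i\<in>?I. e (\<pi> i))\<^sup>2 = 2 ^ l * blk_noise e (\<pi> ` ?I)"
      unfolding blk_noise_def card by simp
    also have "\<dots> \<le> 2 ^ l * (4 * \<sigma>\<^sup>2 * (ln R + expsq \<sigma> e (\<pi> ` ?I) / R))"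
      by (intro mult_left_mono blk_noise_le[OF s R]) auto
    also have "\<dots> \<le> 2 ^ l * (4 * \<sigma>\<^sup>2 * (A + 2 * ln (real p + 1)))"
    proof (intro mult_left_mono)
      \<comment> \<open>The block's own weighted exponential is one term of the nonnegative sum
        \<open>W\<close>, so a single random quantity serves all prefixes at once.\<close>
      have "(case (l, p) of (l, p) \<Rightarrow> 1 / (real L * (real p + 1)\<^sup>2) * expsq \<sigma> e (\<pi> ` {p * 2 ^ l..<(p + 1) * 2 ^ l})) \<le> W"
        unfolding W_def by (rule member_le_sum[OF mem]) (auto simp: expsq_def)
      then have "expsq \<sigma> e (\<pi> ` ?I) / R \<le> W" by (simp add: R_def)
      then show "ln R + expsq \<sigma> e (\<pi> ` ?I) / R \<le> A + 2 * ln (real p + 1)" by (simp add: lnR A_def)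
    qed auto
    finally show "(\<Sum>i\<in>?I. e (\<pi> i))\<^sup>2 \<le> 4 * \<sigma>\<^sup>2 * 2 ^ l * (A + 2 * ln (real p + 1))" by (simp add: mult_ac)
  qed
  moreover have "inj_on \<pi> {..<m}" by (rule inj_on_subset[OF inj]) (use m in auto)
  ultimately show ?thesis
    using m by (simp add: blk_noise_def sum.reindex card_image A_def[symmetric] divide_le_eq)
qed

lemma minimax_upper_two_pieces:
  assumes s: "0 < \<sigma>" and n: "2 \<le> n"
  shows "minimax_risk n 2 \<sigma> \<le> ennreal (233472 * (\<sigma>\<^sup>2 * ln (ln (16 * real n))))"
proof -
  obtain est where est: "est \<in> estimators n"
    "\<And>x. \<exists>A \<subseteq> {1..<n}. card A \<le> 1 \<and> jumps n (est x) \<subseteq> A"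
    "\<And>x v. card (jumps n v) \<le> 1 \<Longrightarrow> (\<Sum>i<n. (x i - est x i)\<^sup>2) \<le> (\<Sum>i<n. (x i - v i)\<^sup>2)"
    using least_squares_estimator[of n 1] by blast
  have "\<exists>a. 2 ^ a \<le> n \<and> n < 2 ^ (a + 1)" by (rule ex_power_ivl1) (use n in auto)
  then obtain a where a: "2 ^ a \<le> n" "n < 2 ^ (a + 1)" by blast
  define L where "L = a + 1"
  have L: "1 \<le> L" "n < 2 ^ L" using a by (auto simp: L_def)
  define \<Lambda> where "\<Lambda> = ln (ln (16 * real n))"
  \<comment> \<open>\<open>L\<close> is the binary length of \<open>n\<close>. For
    \<open>n \<ge> 2\<close> the inner logarithm exceeds \<open>exp 1\<close>, so
    \<open>\<Lambda>\<close> is at least 1 and can absorb additive constants.\<close>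
  have L_le: "ln (real L) \<le> 1 + \<Lambda>" and L1: "1 \<le> \<Lambda>"
  proof -
    have "real (2 ^ a) \<le> real n" using a(1) by (simp only: of_nat_le_iff)
    then have "(2::real) ^ (a + 4) \<le> 16 * real n" by (simp add: power_add)
    then have "ln (2 ^ (a + 4)) \<le> ln (16 * real n)" using n by (subst ln_le_cancel_iff) auto
    moreover have "ln ((2::real) ^ (a + 4)) = real (a + 4) * ln 2" by (rule ln_realpow)
    moreover have "real (a + 4) * (2 / 3) \<le> real (a + 4) * ln 2" using ln2_ge_two_thirds by (intro mult_left_mono) auto
    ultimately have *: "real (a + 4) * (2 / 3) \<le> ln (16 * real n)" by linarith
    then have "real L \<le> 2 * ln (16 * real n)" by (simp add: L_def)
    then have "ln (real L) \<le> ln (2 * ln (16 * real n))" using L by (subst ln_le_cancel_iff) auto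
    also have "\<dots> = ln 2 + \<Lambda>" unfolding \<Lambda>_def using * by (subst ln_mult_pos) auto
    finally show "ln (real L) \<le> 1 + \<Lambda>" using ln_2_less_1 by linarith
    have "a \<noteq> 0" using a n by (intro notI) simp
    then have "3 \<le> ln (16 * real n)" using * by (cases a) auto
    then have "exp 1 \<le> ln (16 * real n)" using exp_le by linarith
    then have "ln (exp 1) \<le> ln (ln (16 * real n))" by (subst ln_le_cancel_iff) (auto intro: less_le_trans[OF exp_gt_zero])
    then show "1 \<le> \<Lambda>" by (simp add: \<Lambda>_def)
  qed
  show ?thesis
  proof (rule minimax_risk_leI[OF est(1)])
    fix \<theta> assume "\<theta> \<in> Theta n 2"
    then have c: "card (jumps n \<theta>) \<le> 1" using ThetaD[of \<theta> n 2] by simp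
    \<comment> \<open>A vector without jumps gets the default change point 0, which is a boundary
      anyway.\<close>
    obtain b where b: "b < n" "jumps n \<theta> \<subseteq> {b}"
    proof (cases "jumps n \<theta> = {}")
      case True
      then show ?thesis using that[of 0] n by simp
    next
      case False
      then have "card (jumps n \<theta>) = 1" using c by (metis card_0_eq finite_jumps le_antisym less_one linorder_not_less)
      then obtain b where "jumps n \<theta> = {b}" by (auto simp: card_1_singleton_iff)
      moreover have "jumps n \<theta> \<subseteq> {1..<n}" by (auto simp: jumps_def)
      ultimately show ?thesis using that[of b] by simp
    qed
    \<comment> \<open>The four enumerations run forwards from \<open>0\<close>, backwards from \<open>n\<close>, forwards from the change
      point \<open>b\<close> and backwards from \<open>b\<close>.\<close>
    define \<pi> where "\<pi> f i = (if f = 0 then i else if f = 1 then n - 1 - i else if f = 2 then b + i else b - 1 - i)" for f i :: nat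
    define M where "M f = (if f = 0 \<or> f = 1 then n else if f = 2 then n - b else b)" for f :: nat
    have inj: "inj_on (\<pi> f) {..<M f}" for f
      by (rule inj_onI) (auto simp: \<pi>_def M_def split: if_splits)
    have ran: "\<pi> f i < n" if "i < M f" for f i
      using that b by (auto simp: \<pi>_def M_def split: if_splits)
    have Mn: "M f < 2 ^ L" for f using b L by (auto simp: M_def)
    define Q where "Q = (SIGMA f:{..<4}. dyads L (M f))"
    define J where "J = (\<lambda>(f, l, p). \<pi> f ` {p * 2 ^ l..<(p + 1) * 2 ^ l})"
    define w where "w = (\<lambda>(f :: nat, l :: nat, p). 12288 * \<sigma>\<^sup>2 * (1 / (real L * (real p + 1)\<^sup>2)))"
    have finQ: "finite Q" by (simp add: Q_def)
    have "risk n \<sigma> est \<theta> \<le> ennreal (12288 * \<sigma>\<^sup>2 * (1 + ln (real L)) + 2 * (\<Sum>q\<in>Q. w q))"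
    proof (rule risk_le_expsq[OF s finQ, where J = J])
      show "J q \<subseteq> {..<n}" if "q \<in> Q" for q
      proof -
        obtain f l p where q: "q = (f, l, p)" by (metis surj_pair)
        have "(p + 1) * 2 ^ l \<le> M f" using that by (simp add: q Q_def dyads_def)
        then show ?thesis using ran[of _ f] by (auto simp: q J_def)
      qed
      show "0 \<le> w q" if "q \<in> Q" for q by (auto simp: w_def split: prod.split)
      show "0 \<le> 12288 * \<sigma>\<^sup>2 * (1 + ln (real L))" using L by simp
      fix x
      define e where "e = (\<lambda>i. x i - \<theta> i)"
      define W where "W f = (\<Sum>(l, p)\<in>dyads L (M f). 1 / (real L * (real p + 1)\<^sup>2) * expsq \<sigma> e (\<pi> f ` {p * 2 ^ l..<(p + 1) * 2 ^ l}))" for f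
      have Wnn: "0 \<le> W f" for f unfolding W_def by (intro sum_nonneg) (auto simp: expsq_def)
      define T where "T = 1024 * \<sigma>\<^sup>2 * (1 + ln (real L) + (\<Sum>f<4. W f))"
      have pre: "blk_noise e (\<pi> f ` {..<m}) \<le> T" if "f < 4" "1 \<le> m" "m \<le> M f" for f m
      proof -
        have "blk_noise e (\<pi> f ` {..<m}) \<le> 1024 * \<sigma>\<^sup>2 * (1 + ln (real L) + W f)"
          unfolding W_def by (rule blk_noise_prefix_le[OF s inj L(1) Mn that(2,3)])
        also have "\<dots> \<le> T"
          unfolding T_def using Wnn that(1) by (intro mult_left_mono add_left_mono member_le_sum) auto
        finally show ?thesis .
      qed
      obtain A where A: "A \<subseteq> {1..<n}" "card A \<le> 1" "jumps n (est x) \<subseteq> A" using est(2) by blast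
      define B where "B = A \<union> jumps n \<theta>"
      have fA: "finite A" using finite_subset[OF A(1)] by simp
      have fB: "finite B" using fA by (simp add: B_def)
      have "card B \<le> card A + card (jumps n \<theta>)" unfolding B_def by (rule card_Un_le)
      then have cB: "card (blks n B) \<le> 3" using card_blks_le[OF fB, of n] A(2) c by linarith
      have bn: "blk_noise e X \<le> T" if X: "X \<in> blks n B" for X
      proof -
        obtain lo hi where X: "X = {lo..<hi}" "lo < hi" "hi \<le> n" "lo = 0 \<or> lo \<in> B" "hi = n \<or> hi \<in> B"
          using blks_interval[OF fB X] by metis
        \<comment> \<open>Otherwise both ends would be fitted jumps, but the fit has at most
          one.\<close>
        have "lo = 0 \<or> hi = n \<or> lo = b \<or> hi = b"
        proof (rule ccontr)
          assume "\<not> (lo = 0 \<or> hi = n \<or> lo = b \<or> hi = b)"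
          then have "{lo, hi} \<subseteq> A" using X b by (auto simp: B_def)
          then have "card {lo, hi} \<le> card A" by (intro card_mono fA)
          then show False using A(2) X(2) by simp
        qed
        then consider "lo = 0" | "hi = n" | "lo = b" | "hi = b" by blast
        then show ?thesis
        proof cases
          case 1
          have "X = \<pi> 0 ` {..<hi}" using 1 X by (auto simp: \<pi>_def)
          then show ?thesis using pre[of 0 hi] X 1 by (simp add: M_def)
        next
          case 2
          have "X = \<pi> 1 ` {..<n - lo}"
          proof (intro set_eqI iffI)
            fix i assume "i \<in> X"
            then show "i \<in> \<pi> 1 ` {..<n - lo}" using X 2 by (intro image_eqI[of _ _ "n - 1 - i"]) (auto simp: \<pi>_def)
          qed (use X 2 in \<open>auto simp: \<pi>_def\<close>)
          then show ?thesis using pre[of 1 "n - lo"] X 2 by (simp add: M_def)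
        next
          case 3
          have "X = \<pi> 2 ` {..<hi - b}"
          proof (intro set_eqI iffI)
            fix i assume "i \<in> X"
            then show "i \<in> \<pi> 2 ` {..<hi - b}" using X 3 by (intro image_eqI[of _ _ "i - b"]) (auto simp: \<pi>_def)
          qed (use X 3 in \<open>auto simp: \<pi>_def\<close>)
          then show ?thesis using pre[of 2 "hi - b"] X 3 by (simp add: M_def)
        next
          case 4
          have "X = \<pi> 3 ` {..<b - lo}"
          proof (intro set_eqI iffI)
            fix i assume "i \<in> X"
            then show "i \<in> \<pi> 3 ` {..<b - lo}" using X 4 by (intro image_eqI[of _ _ "b - 1 - i"]) (auto simp: \<pi>_def)
          qed (use X 4 in \<open>auto simp: \<pi>_def\<close>)
          then show ?thesis using pre[of 3 "b - lo"] X 4 by (simp add: M_def)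
        qed
      qed
      have T: "0 \<le> T" unfolding T_def using L Wnn by (simp add: sum_nonneg)
      have "(\<Sum>i<n. (est x i - \<theta> i)\<^sup>2) \<le> 4 * (\<Sum>X\<in>blks n B. blk_noise e X)"
        unfolding e_def using est(3)[OF c] A fB by (intro least_squares_loss) (auto simp: B_def)
      also have "(\<Sum>X\<in>blks n B. blk_noise e X) \<le> real (card (blks n B)) * T"
        using sum_bounded_above[of "blks n B" "blk_noise e" T] bn by simp
      also have "\<dots> \<le> 3 * T" using cB T by (intro mult_right_mono) auto
      also have "4 * (3 * T) = 12288 * \<sigma>\<^sup>2 * (1 + ln (real L)) + 12288 * \<sigma>\<^sup>2 * (\<Sum>f<4. W f)"
        by (simp add: T_def algebra_simps)
      also have "12288 * \<sigma>\<^sup>2 * (\<Sum>f<4. W f) = (\<Sum>f<4. \<Sum>y\<in>dyads L (M f). w (f, y) * expsq \<sigma> e (J (f, y)))"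
        unfolding sum_distrib_left W_def w_def J_def
        by (intro sum.cong refl) (auto simp: mult.assoc split: prod.split)
      also have "\<dots> = (\<Sum>q\<in>Q. w q * expsq \<sigma> e (J q))"
        unfolding Q_def by (subst sum.Sigma) (auto simp: case_prod_beta)
      finally show "(\<Sum>i<n. (est x i - \<theta> i)\<^sup>2) \<le> 12288 * \<sigma>\<^sup>2 * (1 + ln (real L)) + (\<Sum>q\<in>Q. w q * expsq \<sigma> (\<lambda>i. x i - \<theta> i) (J q))"
        by (simp add: e_def)
    qed
    also have "\<dots> \<le> ennreal (233472 * (\<sigma>\<^sup>2 * \<Lambda>))"
    proof (rule ennreal_leI)
      \<comment> \<open>Here 12288 = 4 * 3 * 1024 for the loss factor, three blocks and chaining.
        Four families of weight at most 2, doubled by the exponential moment, add 16; then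
        \<open>17 + ln L \<le> 18 + \<Lambda> \<le> 19 * \<Lambda>\<close>, and 19 * 12288 =
        233472.\<close>
      have "(\<Sum>q\<in>Q. w q) = (\<Sum>f<4. \<Sum>y\<in>dyads L (M f). w (f, y))"
        unfolding Q_def by (subst sum.Sigma) (auto simp: case_prod_beta)
      also have "\<dots> = 12288 * \<sigma>\<^sup>2 * (\<Sum>f<4. \<Sum>(l, p)\<in>dyads L (M f). 1 / (real L * (real p + 1)\<^sup>2))"
        unfolding sum_distrib_left w_def by (intro sum.cong refl) (auto split: prod.split)
      also have "\<dots> \<le> 12288 * \<sigma>\<^sup>2 * (\<Sum>f<(4::nat). 2)"
        by (intro mult_left_mono sum_mono sum_dyads_le L) auto
      finally have "12288 * \<sigma>\<^sup>2 * (1 + ln (real L)) + 2 * (\<Sum>q\<in>Q. w q) \<le> \<sigma>\<^sup>2 * (12288 * (17 + ln (real L)))"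
        by (simp add: algebra_simps)
      also have "\<dots> \<le> \<sigma>\<^sup>2 * (233472 * \<Lambda>)" using L_le L1 by (intro mult_left_mono) auto
      finally show "12288 * \<sigma>\<^sup>2 * (1 + ln (real L)) + 2 * (\<Sum>q\<in>Q. w q) \<le> 233472 * (\<sigma>\<^sup>2 * \<Lambda>)" by (simp add: mult_ac)
    qed
    finally show "risk n \<sigma> est \<theta> \<le> ennreal (233472 * (\<sigma>\<^sup>2 * ln (ln (16 * real n))))" by (simp add: \<Lambda>_def)
  qed
qed

section \<open>Assembly of the three regimes\<close>

theorem mainTheorem6:
  shows "\<exists>c C :: real. 0 < c \<and> 0 < C \<and>
    (\<forall>n k (\<sigma>::real). 1 \<le> k \<and> k \<le> n \<and> 0 < \<sigma> \<longrightarrow>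
       ennreal (c * rate n k \<sigma>) \<le> minimax_risk n k \<sigma> \<and>
       minimax_risk n k \<sigma> \<le> ennreal (C * rate n k \<sigma>))"
\<comment> \<open>Both constants come from two pieces: the lower constants are 1/20, 1/240 and
  1/192, the upper ones 32, 233472 and 128.\<close>
proof (rule exI[of _ "1 / 240"], rule exI[of _ "233472"], intro conjI allI impI)
  fix n k :: nat and \<sigma> :: real
  assume "1 \<le> k \<and> k \<le> n \<and> 0 < \<sigma>"
  then have k: "1 \<le> k" "k \<le> n" and s: "0 < \<sigma>" by auto
  consider "k = 1" | "k = 2" | "3 \<le> k" using k by linarith
  then have "ennreal (1 / 240 * rate n k \<sigma>) \<le> minimax_risk n k \<sigma> \<and> minimax_risk n k \<sigma> \<le> ennreal (233472 * rate n k \<sigma>)"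
  proof cases
    case 1
    have "ennreal (1 / 240 * rate n k \<sigma>) \<le> ennreal (\<sigma>\<^sup>2 / 20)"
      by (rule ennreal_leI) (simp add: 1 rate_def)
    also have "\<dots> \<le> minimax_risk n k \<sigma>" by (rule minimax_lower_constant) (use s k in auto)
    finally have lower: "ennreal (1 / 240 * rate n k \<sigma>) \<le> minimax_risk n k \<sigma>" .
    have "minimax_risk n k \<sigma> \<le> ennreal (32 * \<sigma>\<^sup>2)" unfolding 1 by (rule minimax_upper_one_piece[OF s])
    also have "\<dots> \<le> ennreal (233472 * rate n k \<sigma>)" by (rule ennreal_leI) (simp add: 1 rate_def)
    finally show ?thesis using lower by blast
  next
    case 2
    then show ?thesis
      using minimax_lower_two_pieces[OF s, of n] minimax_upper_two_pieces[OF s, of n] k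
      by (simp add: rate_def)
  next
    case 3
    define r where "r = \<sigma>\<^sup>2 * real k * ln (exp 1 * real n / real k)"
    \<comment> \<open>The argument of the logarithm is at least 1, so the rate is nonnegative and
      constants may be weakened.\<close>
    have "1 * real k \<le> exp 1 * real n" using k exp_ge_add_one_self[of "1::real"] by (intro mult_mono) auto
    then have r: "0 \<le> r" unfolding r_def using k by (intro mult_nonneg_nonneg ln_ge_zero) (auto simp: le_divide_eq)
    have rate: "rate n k \<sigma> = r" using 3 by (simp add: rate_def r_def)
    have "ennreal (1 / 240 * r) \<le> ennreal (r / 192)" using r by (intro ennreal_leI) simp
    also have "\<dots> \<le> minimax_risk n k \<sigma>"
      unfolding r_def by (rule minimax_lower_many_pieces[OF s 3 k(2)])
    finally have lower: "ennreal (1 / 240 * r) \<le> minimax_risk n k \<sigma>" .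
    have "minimax_risk n k \<sigma> \<le> ennreal (128 * r)"
      unfolding r_def by (rule minimax_upper_many_pieces[OF s k])
    also have "\<dots> \<le> ennreal (233472 * r)" using r by (intro ennreal_leI) simp
    finally show ?thesis unfolding rate using lower by blast
  qed
  then show "ennreal (1 / 240 * rate n k \<sigma>) \<le> minimax_risk n k \<sigma>"
    "minimax_risk n k \<sigma> \<le> ennreal (233472 * rate n k \<sigma>)" by blast+
qed auto

end
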